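(* Let $\nu\ge 3$ be a square-free integer with $\nu\equiv 2$ or $3 \pmod 4$. Define $x_0=0$ and $x_{n+1}=\sqrt{x_n+\nu}$ for $n\ge0$. For $n\ge 0$ let $P_n\in\mathbb{Z}[t]$ be the minimal polynomial of $x_n$ over $\mathbb{Q}$ and $C_n$ its constant term. Let $p$ be a prime number which divides $C_n$ for some $n\ge1$, and let $n(p)$ be the least positive integer $n$ such that $p$ divides $C_n$. (1) If $p^2$ does not divide $C_{n(p)}$, then for every $n\ge1$ and every maximal ideal $\mathcal{P}$ of $\mathbb{Z}[x_n]$ with $\mathcal{P}\cap\mathbb{Z}=p\mathbb{Z}$, the localization $\mathbb{Z}[x_n]_{\mathcal{P}}$ is a discrete valuation ring. (2) If for every maximal ideal $\mathcal{P}$ of $\mathbb{Z}[x_{n(p)}]$ with $\mathcal{P}\cap\mathbb{Z}=p\mathbb{Z}$ the localization $\mathbb{Z}[x_{n(p)}]_{\mathcal{P}}$ is a discrete valuation ring, then $p^2$ does not divide $C_{n(p)}$.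
   Context: The square roots are the positive real ones. It is known that $P_n(t)=(t^2-\nu)^{\circ n}$ (the $n$-fold composition of $t^2-\nu$ with itself), so $P_0(t)=t$ and $C_0=0$. *)

theory Defs
  imports Complex_Main "HOL-Computational_Algebra.Polynomial" "HOL-Computational_Algebra.Squarefree"
    "HOL-Algebra.Ring_Divisibility" "HOL-Algebra.Ideal"
begin

fun xseq :: "int \<Rightarrow> nat \<Rightarrow> real" where
  "xseq \<nu> 0 = 0"
| "xseq \<nu> (Suc n) = sqrt (xseq \<nu> n + of_int \<nu>)"

definition minpoly_Q :: "real \<Rightarrow> rat poly" where
  "minpoly_Q a = (THE m. lead_coeff m = 1 \<and> Polynomial.poly (map_poly of_rat m) a = 0 \<and>
     (\<forall>q. q \<noteq> 0 \<longrightarrow> Polynomial.poly (map_poly of_rat q) a = 0 \<longrightarrow> Polynomial.degree m \<le> Polynomial.degree q))"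

definition Cn :: "int \<Rightarrow> nat \<Rightarrow> int" where
  "Cn \<nu> n = (THE c. of_int c = Polynomial.coeff (minpoly_Q (xseq \<nu> n)) 0)"

definition np :: "int \<Rightarrow> nat \<Rightarrow> nat" where
  "np \<nu> p = (LEAST n. n \<ge> 1 \<and> int p dvd Cn \<nu> n)"

definition Zadj :: "real \<Rightarrow> real set" where
  "Zadj a = {Polynomial.poly (map_poly of_int q) a | q :: int poly. True}"

definition real_ring :: "real set \<Rightarrow> real ring" where
  "real_ring A = \<lparr>carrier = A, monoid.mult = (*), one = 1, zero = 0, add = (+)\<rparr>"

text \<open>Localization of a subring A of the field R at a prime ideal P, realized
  inside the fraction field (as a subring of R).\<close>
definition localization :: "real set \<Rightarrow> real set \<Rightarrow> real set" where
  "localization A P = {a / b | a b. a \<in> A \<and> b \<in> A \<and> b \<notin> P}"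

definition DVR :: "('a, 'b) ring_scheme \<Rightarrow> bool" where
  "DVR R \<longleftrightarrow> principal_domain R \<and>
     (\<exists>M. maximalideal M R \<and> M \<noteq> {\<zero>\<^bsub>R\<^esub>} \<and> (\<forall>M'. maximalideal M' R \<longrightarrow> M' = M))"

end

theory Submission
  imports Defs
begin

text \<open>
  Write $f(t)=t^2-\nu$. For even $n>0$ the iterate $f^n$ is Eisenstein at 2, and irreducibility
  of $f^{n+1}$ forces that of $f^n$, so $P_n=f^n$ and $C_n=f^n(0)$ is the orbit of 0. This orbit
  is periodic modulo $p$, and even modulo $p^2$ after the first step, so $p^2\nmid C_{n(p)}$ implies
  $p^2\nmid C_j$ whenever $p\mid C_j$.

  A prime $\mathcal P$ of $\mathbb{Z}[x_n]$ above $p$ is generated by $p$ and some $g(x_n)$. Since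
  $P_n'(x_n)=\prod_{j=1}^n 2x_j$, for odd $p$ either $P_n'(x_n)\notin\mathcal P$ and $p$ is a
  uniformizer, or some $x_j\in\mathcal P$. In the latter case $0=P_j(x_j)=C_j+x_j^2h(x_j)$ puts
  $p$ into $\mathcal P^2$ locally, and $g(x_n)$ is a uniformizer. For $p=2$ the remaining case is
  $x_1-1\in\mathcal P$ with $\nu\equiv 3$ modulo 4, where $(x_1-1)^2$ is 2 times a local unit.

  Conversely, if $p^2\mid C_n$ with $n=n(p)$, then $P_n\in(p,t)^2$, so at $\mathcal P=(p,x_n)$
  neither of $p$ and $x_n$ divides the other, which is impossible in a valuation ring.
\<close>

section \<open>Subrings of the reals and their localizations\<close>

hide_const (open) up_ring.coeff up_ring.monom module.smult Divisibility.prime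

lemma real_ring_simps [simp]:
  "carrier (real_ring A) = A" "x \<otimes>\<^bsub>real_ring A\<^esub> y = x * y" "\<one>\<^bsub>real_ring A\<^esub> = 1"
  "\<zero>\<^bsub>real_ring A\<^esub> = 0" "x \<oplus>\<^bsub>real_ring A\<^esub> y = x + y"
  by (simp_all add: real_ring_def)

locale real_subring =
  fixes A :: "real set"
  assumes one_mem: "1 \<in> A"
    and diff_mem: "a \<in> A \<Longrightarrow> b \<in> A \<Longrightarrow> a - b \<in> A"
    and mult_mem: "a \<in> A \<Longrightarrow> b \<in> A \<Longrightarrow> a * b \<in> A"
begin

lemma zero_mem: "0 \<in> A"
  using diff_mem[OF one_mem one_mem] by simp

lemma uminus_mem: "a \<in> A \<Longrightarrow> - a \<in> A"
  using diff_mem[OF zero_mem] by fastforce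

lemma add_mem: "a \<in> A \<Longrightarrow> b \<in> A \<Longrightarrow> a + b \<in> A"
  using diff_mem[OF _ uminus_mem] by fastforce

lemma power_mem: "a \<in> A \<Longrightarrow> a ^ k \<in> A"
  by (induction k) (auto intro: one_mem mult_mem)

lemma of_nat_mem: "of_nat k \<in> A"
  by (induction k) (auto intro: zero_mem one_mem add_mem)

lemma of_int_mem: "of_int k \<in> A"
  by (cases k) (auto intro!: of_nat_mem diff_mem uminus_mem add_mem one_mem)

lemma domain_real_ring: "domain (real_ring A)"
proof (intro domainI cringI)
  show "abelian_group (real_ring A)"
  proof (rule abelian_groupI)
    fix x assume "x \<in> carrier (real_ring A)"
    then show "\<exists>y\<in>carrier (real_ring A). y \<oplus>\<^bsub>real_ring A\<^esub> x = \<zero>\<^bsub>real_ring A\<^esub>"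
      by (intro bexI[of _ "- x"]) (auto intro: uminus_mem)
  qed (auto intro: add_mem zero_mem)
  show "Group.comm_monoid (real_ring A)"
    by (rule comm_monoidI) (auto intro: mult_mem one_mem)
qed (auto simp: algebra_simps)

lemma cring_real_ring: "cring (real_ring A)"
  using domain_real_ring by (rule domain.axioms)

lemma ring_real_ring: "ring (real_ring A)"
  using cring_real_ring by (rule cring.axioms)

lemma ideal_real_ringI:
  assumes "I \<subseteq> A" "0 \<in> I" "\<And>a b. a \<in> I \<Longrightarrow> b \<in> I \<Longrightarrow> a + b \<in> I"
    and "\<And>a b. a \<in> I \<Longrightarrow> b \<in> A \<Longrightarrow> b * a \<in> I"
  shows "ideal I (real_ring A)"
proof (rule idealI[OF ring_real_ring])
  interpret R: abelian_group "real_ring A"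
    using ring_real_ring by (rule ring.axioms)
  have "\<ominus>\<^bsub>real_ring A\<^esub> a = (- 1) * a" if "a \<in> I" for a
  proof (rule R.minus_equality)
    show "(- 1) * a \<in> carrier (real_ring A)"
      using that assms(1) uminus_mem by auto
  qed (use that assms(1) in auto)
  moreover have "(- 1) * a \<in> I" if "a \<in> I" for a
    using assms(4) that uminus_mem[OF one_mem] by blast
  ultimately show "subgroup I (add_monoid (real_ring A))"
    using assms by (intro R.add.subgroupI) (auto simp: a_inv_def)
qed (use assms(4) in \<open>auto simp: mult.commute\<close>)

lemma ideal_memD:
  assumes "ideal I (real_ring A)"
  shows ideal_subset: "I \<subseteq> A" and ideal_zero: "0 \<in> I"
    and ideal_add: "\<And>a b. a \<in> I \<Longrightarrow> b \<in> I \<Longrightarrow> a + b \<in> I"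
    and ideal_mult: "\<And>a b. a \<in> I \<Longrightarrow> b \<in> A \<Longrightarrow> b * a \<in> I"
proof -
  interpret I: ideal I "real_ring A" by fact
  show "I \<subseteq> A" "0 \<in> I"
    using I.a_subset additive_subgroup.zero_closed[OF ideal.axioms(1)[OF assms]] by simp_all
  show "a + b \<in> I" if "a \<in> I" "b \<in> I" for a b
    using additive_subgroup.a_closed[OF ideal.axioms(1)[OF assms]] that by simp
  show "b * a \<in> I" if "a \<in> I" "b \<in> A" for a b
    using I.I_l_closed that by simp
qed

lemma cgenideal_real_ring: "PIdl\<^bsub>real_ring A\<^esub> a = {b * a | b. b \<in> A}"
  by (simp add: cgenideal_def)

text \<open>Every element is a unit or a multiple of \<open>\<pi>\<close>, and
  \<open>1 / \<pi> \<notin> A\<close> keeps the multiples of \<open>\<pi>\<close> proper, so they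
  form the only maximal ideal. A nonzero ideal is generated by the least power of
  \<open>\<pi>\<close> that it contains.\<close>

lemma DVR_if_uniformizer:
  assumes pi: "\<pi> \<in> A" "\<pi> \<noteq> 0" "1 / \<pi> \<notin> A"
    and fact: "\<And>a. a \<in> A \<Longrightarrow> a \<noteq> 0 \<Longrightarrow> \<exists>k u. a = u * \<pi> ^ k \<and> u \<in> A \<and> 1 / u \<in> A"
  shows "DVR (real_ring A)"
proof -
  let ?M = "{b * \<pi> | b. b \<in> A}"
  have unit_or_M: "1 / a \<in> A \<or> a \<in> ?M" if "a \<in> A" for a
  proof (cases "a = 0")
    case False
    with that obtain k u where ku: "a = u * \<pi> ^ k" "u \<in> A" "1 / u \<in> A"
      using fact by blast
    show ?thesis
    proof (cases k)
      case 0 then show ?thesis using ku by simp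
    next
      case (Suc j)
      then have "a = (u * \<pi> ^ j) * \<pi>" using ku by simp
      then show ?thesis using ku(2) pi(1) mult_mem power_mem by blast
    qed
  qed (use zero_mem in auto)
  have ideal_unit: "I = A" if "ideal I (real_ring A)" "a \<in> I" "1 / a \<in> A" "a \<noteq> 0" for I a
  proof -
    have "1 \<in> I" using ideal_mult[OF that(1,2,3)] that(4) by simp
    then show ?thesis
      using ideal_mult[OF that(1), of 1] ideal_subset[OF that(1)] by auto
  qed
  have M_ideal: "ideal ?M (real_ring A)"
  proof (rule ideal_real_ringI)
    show "?M \<subseteq> A" using mult_mem pi(1) by auto
    show "0 \<in> ?M" using zero_mem by force
    show "a + b \<in> ?M" if ab: "a \<in> ?M" "b \<in> ?M" for a b
    proof -
      obtain a' b' where "a' \<in> A" "b' \<in> A" "a = a' * \<pi>" "b = b' * \<pi>" using ab by auto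
      then show ?thesis
        by (auto intro!: exI[of _ "a' + b'"] simp: algebra_simps add_mem)
    qed
    show "b * a \<in> ?M" if ab: "a \<in> ?M" "b \<in> A" for a b
    proof -
      obtain a' where "a' \<in> A" "a = a' * \<pi>" using ab by auto
      then show ?thesis
        using ab by (auto intro!: exI[of _ "b * a'"] simp: mult_mem)
    qed
  qed
  have one_notin_M: "1 \<notin> ?M"
  proof
    assume "1 \<in> ?M"
    then obtain b where "1 = b * \<pi>" "b \<in> A" by auto
    then have "1 / \<pi> = b" using pi(2) by (simp add: field_simps)
    then show False using pi(3) \<open>b \<in> A\<close> by simp
  qed
  have M_max: "maximalideal ?M (real_ring A)"
  proof (rule maximalidealI[OF M_ideal])
    show "carrier (real_ring A) \<noteq> ?M"
      unfolding real_ring_simps using one_notin_M one_mem by blast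
    fix J assume J: "ideal J (real_ring A)" "?M \<subseteq> J" "J \<subseteq> carrier (real_ring A)"
    show "J = ?M \<or> J = carrier (real_ring A)"
    proof (cases "J = ?M")
      case False
      then obtain a where a: "a \<in> J" "a \<notin> ?M" using J(2) by auto
      then have "1 / a \<in> A" using unit_or_M J(3) by auto
      moreover have "a \<noteq> 0" using a(2) zero_mem by force
      ultimately show ?thesis using ideal_unit J(1) a(1) by simp
    qed simp
  qed
  have M_unique: "M' = ?M" if M': "maximalideal M' (real_ring A)" for M'
  proof -
    interpret M': maximalideal M' "real_ring A" by fact
    have id: "ideal M' (real_ring A)" by (rule M'.ideal_axioms)
    have "M' \<subseteq> ?M"
    proof
      fix a assume a: "a \<in> M'"
      show "a \<in> ?M"
      proof (rule ccontr)
        assume n: "a \<notin> ?M"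
        then have "1 / a \<in> A" using unit_or_M a ideal_subset[OF id] by auto
        moreover have "a \<noteq> 0" using n zero_mem by force
        ultimately have "M' = A" using ideal_unit[OF id a] by simp
        then show False using M'.I_notcarr by simp
      qed
    qed
    moreover have "?M \<subseteq> A" using mult_mem pi(1) by auto
    ultimately have "?M = M' \<or> ?M = A" using M'.I_maximal[OF M_ideal] by simp
    moreover have "?M \<noteq> A" using one_notin_M one_mem by blast
    ultimately show ?thesis by blast
  qed
  have gen: "\<exists>a\<in>carrier (real_ring A). I = PIdl\<^bsub>real_ring A\<^esub> a"
    if I: "ideal I (real_ring A)" for I
  proof (cases "I = {0}")
    case True
    then show ?thesis
      using zero_mem by (auto simp: cgenideal_real_ring intro!: bexI[of _ 0])
  next
    case False
    then obtain a where a: "a \<in> I" "a \<noteq> 0" using ideal_zero[OF I] by auto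
    have pow: "\<exists>k u. a = u * \<pi> ^ k \<and> u \<in> A \<and> \<pi> ^ k \<in> I" if "a \<in> I" "a \<noteq> 0" for a
    proof -
      obtain k u where ku: "a = u * \<pi> ^ k" "u \<in> A" "1 / u \<in> A"
        using fact \<open>a \<in> I\<close> \<open>a \<noteq> 0\<close> ideal_subset[OF I] by blast
      then have "\<pi> ^ k = 1 / u * a" using \<open>a \<noteq> 0\<close> by auto
      then show ?thesis using ku ideal_mult[OF I that(1), of "1 / u"] by auto
    qed
    then have ex: "\<exists>k. \<pi> ^ k \<in> I" using a by blast
    define m where "m = (LEAST k. \<pi> ^ k \<in> I)"
    have m: "\<pi> ^ m \<in> I" using LeastI_ex[OF ex] by (simp add: m_def)
    have "I \<subseteq> {b * \<pi> ^ m | b. b \<in> A}"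
    proof
      fix a assume aI: "a \<in> I"
      show "a \<in> {b * \<pi> ^ m | b. b \<in> A}"
      proof (cases "a = 0")
        case False
        then obtain k u where ku: "a = u * \<pi> ^ k" "u \<in> A" "\<pi> ^ k \<in> I" using pow aI by blast
        then have "m \<le> k" by (simp add: m_def Least_le)
        then have "a = (u * \<pi> ^ (k - m)) * \<pi> ^ m" using ku by (simp flip: power_add)
        then show ?thesis using ku mult_mem power_mem pi(1) by blast
      qed (use zero_mem in force)
    qed
    moreover have "{b * \<pi> ^ m | b. b \<in> A} \<subseteq> I" using ideal_mult[OF I m] by auto
    ultimately show ?thesis
      using pi(1) power_mem by (auto simp: cgenideal_real_ring intro!: bexI[of _ "\<pi> ^ m"])
  qed
  have "principal_domain (real_ring A)"
    by (intro principal_domain.intro principal_domain_axioms.intro domain_real_ring gen)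
  moreover have "\<pi> \<in> ?M" using one_mem by force
  then have "?M \<noteq> {0}" using pi(2) by blast
  ultimately show ?thesis
    unfolding DVR_def real_ring_simps using M_max M_unique by blast
qed

end

section \<open>Localization at a prime ideal\<close>

locale real_prime_ideal = real_subring +
  fixes P :: "real set"
  assumes prime_P: "primeideal P (real_ring A)"
begin

lemma P_ideal: "ideal P (real_ring A)"
  using prime_P by (rule primeideal.axioms)

lemmas P_subset = ideal_subset[OF P_ideal]
  and P_zero = ideal_zero[OF P_ideal]
  and P_add = ideal_add[OF P_ideal]
  and P_mult = ideal_mult[OF P_ideal]

lemma P_mult_right: "a \<in> P \<Longrightarrow> b \<in> A \<Longrightarrow> a * b \<in> P"
  using P_mult by (simp add: mult.commute)

lemma P_uminus: "a \<in> P \<Longrightarrow> - a \<in> P"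
  using P_mult[of a "- 1"] uminus_mem[OF one_mem] by simp

lemma P_diff: "a \<in> P \<Longrightarrow> b \<in> P \<Longrightarrow> a - b \<in> P"
  using P_add[OF _ P_uminus] by fastforce

lemma P_primeD: "a \<in> A \<Longrightarrow> b \<in> A \<Longrightarrow> a * b \<in> P \<Longrightarrow> a \<in> P \<or> b \<in> P"
  using primeideal.I_prime[OF prime_P] by simp

lemma P_power: "a \<in> A \<Longrightarrow> a ^ k \<in> P \<Longrightarrow> a \<in> P"
proof (induction k)
  case 0
  then show ?case using P_mult[of 1 a] by simp
next
  case (Suc k)
  then show ?case using P_primeD[of a "a ^ k"] power_mem by auto
qed

lemma one_notin_P: "1 \<notin> P"
proof
  assume "1 \<in> P"
  then have "A \<subseteq> P" using P_mult by fastforce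
  then show False using P_subset primeideal.I_notcarr[OF prime_P] by simp
qed

abbreviation loc :: "real set" where "loc \<equiv> localization A P"

lemma locI: "a \<in> A \<Longrightarrow> b \<in> A \<Longrightarrow> b \<notin> P \<Longrightarrow> a / b \<in> loc"
  by (auto simp: localization_def)

lemma locE:
  assumes "l \<in> loc"
  obtains a b where "l = a / b" "a \<in> A" "b \<in> A" "b \<notin> P" "b \<noteq> 0"
  using assms P_zero by (fastforce simp: localization_def)

lemma A_loc: "a \<in> A \<Longrightarrow> a \<in> loc"
  using locI[of a 1] one_mem one_notin_P by simp

sublocale loc: real_subring loc
proof
  show "1 \<in> loc" using A_loc one_mem .
  fix x y assume "x \<in> loc" "y \<in> loc"
  then obtain a b c d where ab: "x = a / b" "a \<in> A" "b \<in> A" "b \<notin> P" "b \<noteq> 0"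
    and cd: "y = c / d" "c \<in> A" "d \<in> A" "d \<notin> P" "d \<noteq> 0"
    by (elim locE)
  have bd: "b * d \<in> A" "b * d \<notin> P" using ab cd mult_mem P_primeD by blast+
  have "x - y = (a * d - c * b) / (b * d)" using ab cd by (simp add: field_simps)
  also have "\<dots> \<in> loc" using bd ab cd by (intro locI diff_mem mult_mem)
  finally show "x - y \<in> loc" .
  have "x * y = (a * c) / (b * d)" using ab cd by simp
  also have "\<dots> \<in> loc" using bd ab cd by (intro locI mult_mem)
  finally show "x * y \<in> loc" .
qed

lemma inverse_notin_loc: "a \<in> P \<Longrightarrow> a \<noteq> 0 \<Longrightarrow> 1 / a \<notin> loc"
proof
  assume a: "a \<in> P" "a \<noteq> 0" "1 / a \<in> loc"
  then obtain c d where "1 / a = c / d" "c \<in> A" "d \<notin> P" "d \<noteq> 0" by (elim locE)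
  then have "d = c * a" using a by (simp add: field_simps)
  then show False using P_mult a \<open>c \<in> A\<close> \<open>d \<notin> P\<close> by simp
qed

text \<open>By \<open>gen\<close>, \<open>\<pi>\<close> generates the maximal ideal of the
  localization; by \<open>bounded\<close>, no nonzero element of \<open>A\<close> is divisible by
  all powers of \<open>\<pi>\<close>. Dividing by \<open>\<pi>\<close> as often as possible
  therefore leaves a unit.\<close>

lemma DVR_loc:
  assumes pi: "\<pi> \<in> P" "\<pi> \<noteq> 0"
    and gen: "\<And>q. q \<in> P \<Longrightarrow> \<exists>l\<in>loc. q = \<pi> * l"
    and bounded: "\<And>a. a \<in> A \<Longrightarrow> a \<noteq> 0 \<Longrightarrow> \<exists>k. \<forall>l\<in>loc. a \<noteq> \<pi> ^ k * l"
  shows "DVR (real_ring loc)"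
proof (rule loc.DVR_if_uniformizer)
  have piA: "\<pi> \<in> A" using pi(1) P_subset by auto
  show "\<pi> \<in> loc" using piA by (rule A_loc)
  show "\<pi> \<noteq> 0" by fact
  show "1 / \<pi> \<notin> loc" using inverse_notin_loc pi by simp
  fix x assume x: "x \<in> loc" "x \<noteq> 0"
  then obtain a b where ab: "x = a / b" "a \<in> A" "b \<in> A" "b \<notin> P" "b \<noteq> 0" by (elim locE)
  have "a \<noteq> 0" using ab x by auto
  have ex: "\<exists>k. \<forall>l\<in>loc. a \<noteq> \<pi> ^ k * l" using bounded ab(2) \<open>a \<noteq> 0\<close> by simp
  \<comment> \<open>This is the first exponent at which divisibility fails. It is not 0, as
    \<open>a\<close> is \<open>\<pi> ^ 0\<close> times itself, so its predecessor \<open>j\<close>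
    is the valuation of \<open>a\<close>.\<close>
  define m where "m = (LEAST k. \<forall>l\<in>loc. a \<noteq> \<pi> ^ k * l)"
  have m: "\<forall>l\<in>loc. a \<noteq> \<pi> ^ m * l" unfolding m_def by (rule LeastI_ex[OF ex])
  then have "m \<noteq> 0" using A_loc ab(2) by (intro notI) auto
  then obtain j where j: "m = Suc j" by (cases m) auto
  have "\<not> (\<forall>l\<in>loc. a \<noteq> \<pi> ^ j * l)"
    using not_less_Least[of j "\<lambda>k. \<forall>l\<in>loc. a \<noteq> \<pi> ^ k * l"] j by (simp add: m_def)
  then obtain l where l: "l \<in> loc" "a = \<pi> ^ j * l" by blast
  then obtain c d where cd: "l = c / d" "c \<in> A" "d \<in> A" "d \<notin> P" "d \<noteq> 0" by (elim locE)
  have "c \<notin> P"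
  proof
    assume "c \<in> P"
    then obtain l' where l': "l' \<in> loc" "c = \<pi> * l'" using gen by blast
    have "a = \<pi> ^ m * (l' / d)" using l(2) cd(1) l'(2) j by simp
    moreover have "l' / d \<in> loc"
      using loc.mult_mem[OF l'(1) locI[OF one_mem cd(3,4)]] by simp
    ultimately show False using m by blast
  qed
  have bd: "b * d \<in> A" "b * d \<notin> P" using ab cd mult_mem P_primeD by blast+
  have "x = (c / (b * d)) * \<pi> ^ j" using ab(1) l(2) cd(1) by (simp add: mult.commute)
  moreover have "c / (b * d) \<in> loc" using bd cd by (intro locI)
  moreover have "1 / (c / (b * d)) \<in> loc" using locI[OF bd(1) cd(2) \<open>c \<notin> P\<close>] by simp
  ultimately show "\<exists>k u. x = u * \<pi> ^ k \<and> u \<in> loc \<and> 1 / u \<in> loc" by blast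
qed

end

section \<open>Integer polynomials at a real point\<close>

abbreviation ipoly :: "int poly \<Rightarrow> real \<Rightarrow> real" where
  "ipoly q x \<equiv> poly (map_poly of_int q) x"

lemma ipoly_simps [simp]:
  "ipoly (q + r) x = ipoly q x + ipoly r x"
  "ipoly (q - r) x = ipoly q x - ipoly r x"
  "ipoly (- q) x = - ipoly q x"
  "ipoly (q * r) x = ipoly q x * ipoly r x"
  "ipoly (smult c q) x = of_int c * ipoly q x"
  "ipoly (pCons c q) x = of_int c + x * ipoly q x"
proof -
  have "map_poly of_int (q + r) = map_poly of_int q + (map_poly of_int r :: real poly)"
    "map_poly of_int (q - r) = map_poly of_int q - (map_poly of_int r :: real poly)"
    "map_poly of_int (- q) = - (map_poly of_int q :: real poly)"
    "map_poly of_int (q * r) = map_poly of_int q * (map_poly of_int r :: real poly)"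
    by (intro poly_eqI; simp add: coeff_map_poly coeff_mult)+
  then show "ipoly (q + r) x = ipoly q x + ipoly r x"
    "ipoly (q - r) x = ipoly q x - ipoly r x"
    "ipoly (- q) x = - ipoly q x"
    "ipoly (q * r) x = ipoly q x * ipoly r x"
    by simp_all
  show "ipoly (smult c q) x = of_int c * ipoly q x"
    by (simp add: map_poly_smult)
  show "ipoly (pCons c q) x = of_int c + x * ipoly q x"
    by (cases "pCons c q = 0") (auto simp: map_poly_pCons)
qed

lemma ipoly_power [simp]: "ipoly (q ^ k) x = ipoly q x ^ k"
  by (induction k) simp_all

lemma ipoly_pcompose: "ipoly (pcompose q r) x = ipoly q (ipoly r x)"
  by (induction q) (auto simp: pcompose_pCons)

section \<open>Irreducibility over the integers and degrees of vanishing polynomials\<close>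

text \<open>Let \<open>i\<close> and \<open>j\<close> be the first indices at which \<open>g\<close>
  and \<open>h\<close> have a coefficient prime to \<open>p\<close>. Then coefficient
  \<open>i + j\<close> of the product is prime to \<open>p\<close>, so \<open>i + j\<close> is the
  full degree. With both degrees positive, \<open>p\<close> would divide both constant terms and its
  square their product.\<close>

lemma eisenstein_criterion:
  fixes p :: int
  assumes p: "prime p" and F: "F = g * h" "F \<noteq> 0"
    and lead: "\<not> p dvd lead_coeff F"
    and low: "\<And>i. i < degree F \<Longrightarrow> p dvd coeff F i"
    and const: "\<not> p\<^sup>2 dvd coeff F 0"
  shows "degree g = 0 \<or> degree h = 0"
proof -
  have lc: "lead_coeff F = lead_coeff g * lead_coeff h" using F by (simp add: lead_coeff_mult)
  have g: "\<not> p dvd lead_coeff g" and h: "\<not> p dvd lead_coeff h"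
    using lead lc by auto
  define i where "i = (LEAST i. \<not> p dvd coeff g i)"
  define j where "j = (LEAST j. \<not> p dvd coeff h j)"
  have i: "\<not> p dvd coeff g i" "i \<le> degree g"
    unfolding i_def using g by (rule LeastI, rule Least_le)
  have j: "\<not> p dvd coeff h j" "j \<le> degree h"
    unfolding j_def using h by (rule LeastI, rule Least_le)
  have i': "p dvd coeff g k" if "k < i" for k
    using not_less_Least that unfolding i_def by blast
  have j': "p dvd coeff h k" if "k < j" for k
    using not_less_Least that unfolding j_def by blast
  have "coeff F (i + j) = (\<Sum>k\<le>i + j. coeff g k * coeff h (i + j - k))"
    using F by (simp add: coeff_mult)
  also have "\<dots> = coeff g i * coeff h j + (\<Sum>k\<in>{..i + j} - {i}. coeff g k * coeff h (i + j - k))"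
    by (subst sum.remove[of _ i]) auto
  finally have eq: "coeff F (i + j) = \<dots>" .
  have "p dvd (\<Sum>k\<in>{..i + j} - {i}. coeff g k * coeff h (i + j - k))"
  proof (rule dvd_sum)
    fix k assume "k \<in> {..i + j} - {i}"
    then consider "k < i" | "i + j - k < j" by fastforce
    then show "p dvd coeff g k * coeff h (i + j - k)"
      using i' j' by cases auto
  qed
  moreover have "\<not> p dvd coeff g i * coeff h j"
    using i(1) j(1) p by (simp add: prime_dvd_mult_iff)
  ultimately have "\<not> p dvd coeff F (i + j)"
    unfolding eq by (simp add: dvd_add_left_iff)
  then have "\<not> i + j < degree F" using low by blast
  moreover have "degree F = degree g + degree h"
    using F by (simp add: degree_mult_eq)
  ultimately have "i = degree g" "j = degree h" using i(2) j(2) by auto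
  moreover have "coeff F 0 = coeff g 0 * coeff h 0" using F by (simp add: coeff_mult_0)
  ultimately show ?thesis
    using const i'[of 0] j'[of 0] mult_dvd_mono[of p "coeff g 0" p "coeff h 0"]
    by (auto simp: power2_eq_square)
qed

text \<open>This is Gauss's lemma at work: a primitive \<open>g\<close> of least degree vanishing at
  \<open>x\<close> pseudo-divides \<open>F\<close>, and comparing contents removes the scalar, which
  gives a factorization of \<open>F\<close> over the integers. As \<open>g\<close> is not constant,
  its cofactor is.\<close>

lemma degree_le_if_root_of_irreducible:
  assumes F: "content F = 1" "ipoly F x = 0"
    and irred: "\<And>g h. F = g * h \<Longrightarrow> degree g = 0 \<or> degree h = 0"
    and q: "q \<noteq> 0" "ipoly q x = 0"
  shows "degree F \<le> degree q"
proof -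
  define N where "N = (LEAST n. \<exists>q. q \<noteq> 0 \<and> ipoly q x = 0 \<and> degree q = n)"
  have "\<exists>q. q \<noteq> 0 \<and> ipoly q x = 0 \<and> degree q = N"
    unfolding N_def by (rule LeastI_ex) (use q in blast)
  then obtain m where m: "m \<noteq> 0" "ipoly m x = 0" "degree m = N" by blast
  have minimal: "N \<le> degree r" if "r \<noteq> 0" "ipoly r x = 0" for r
    unfolding N_def by (rule Least_le) (use that in blast)
  define g where "g = primitive_part m"
  have mg: "smult (content m) g = m" by (simp add: g_def)
  have "content m \<noteq> 0" using m(1) by simp
  then have g: "g \<noteq> 0" "ipoly g x = 0" "degree g = N" "content g = 1"
    using m arg_cong[OF mg, of "\<lambda>m. ipoly m x"]
    by (auto simp: g_def simp del: content_times_primitive_part)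
  obtain a b where ab: "a \<noteq> 0" "smult a F = g * b + pseudo_mod F g"
    using pseudo_mod(1)[OF g(1)] by blast
  have deg: "pseudo_mod F g = 0 \<or> degree (pseudo_mod F g) < degree g"
    by (rule pseudo_mod(2)[OF g(1)])
  have "ipoly (pseudo_mod F g) x = 0"
    using arg_cong[OF ab(2), of "\<lambda>m. ipoly m x"] F(2) g(2) by simp
  then have "pseudo_mod F g = 0" using deg minimal g(3) by fastforce
  then have aF: "smult a F = g * b" using ab by simp
  then have "content (smult a F) = content b"
    using g(4) by (simp add: content_mult)
  then have cb: "content b = \<bar>a\<bar>" using F(1) by simp
  have "smult a F = smult \<bar>a\<bar> (g * primitive_part b)"
    using aF cb content_times_primitive_part[of b] by (metis mult_smult_right)
  \<comment> \<open>Contents are nonnegative, so the sign of \<open>a\<close> has to move into the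
    cofactor before \<open>a\<close> can be cancelled.\<close>
  then have "smult a F = smult a (g * smult (sgn a) (primitive_part b))"
    by (simp add: abs_sgn)
  then have gb: "F = g * smult (sgn a) (primitive_part b)"
    using ab(1) smult_cancel[of a F] by (simp del: mult_smult_right)
  from irred[OF gb] have "degree g = 0 \<or> degree (smult (sgn a) (primitive_part b)) = 0" .
  moreover have "degree g \<noteq> 0"
  proof
    assume "degree g = 0"
    then obtain c where "g = [:c:]" by (rule degree_eq_zeroE)
    then show False using g by simp
  qed
  moreover have "F \<noteq> 0" using F(1) by auto
  then have "degree F = degree g + degree (smult (sgn a) (primitive_part b))"
    unfolding gb by (intro degree_mult_eq) auto
  ultimately show ?thesis using minimal[OF q] g(3) by simp
qed

text \<open>Pseudo-division scales the dividend by a power of the leading coefficient, which is 1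
  here.\<close>

lemma monic_division:
  fixes F q :: "'a::{comm_ring_1,semiring_1_no_zero_divisors} poly"
  assumes "lead_coeff F = 1"
  obtains s r where "q = F * s + r" "r = 0 \<or> degree r < degree F"
proof -
  have F0: "F \<noteq> 0" using assms by auto
  obtain s r where sr: "pseudo_divmod q F = (s, r)" by force
  show thesis
    using that[of s r] pseudo_divmod[OF F0 sr] assms by simp
qed

section \<open>The iterates of $t^2-\nu$\<close>

fun iterpoly :: "int \<Rightarrow> nat \<Rightarrow> int poly" where
  "iterpoly \<nu> 0 = [:0, 1:]"
| "iterpoly \<nu> (Suc n) = (iterpoly \<nu> n)\<^sup>2 - [:\<nu>:]"

text \<open>As 0 is the critical point of t^2 - \<open>\<nu>\<close>, this is the critical orbit; it
  will turn out to be C_n.\<close>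

abbreviation crit :: "int \<Rightarrow> nat \<Rightarrow> int" where
  "crit \<nu> n \<equiv> poly (iterpoly \<nu> n) 0"

lemma iterpoly_monic: "degree (iterpoly \<nu> n) = 2 ^ n \<and> lead_coeff (iterpoly \<nu> n) = 1"
proof (induction n)
  case (Suc n)
  let ?F = "iterpoly \<nu> n"
  have sq: "degree (?F\<^sup>2) = 2 ^ Suc n" "lead_coeff (?F\<^sup>2) = 1"
    using Suc lead_coeff_power[of ?F 2] degree_power_eq[of ?F 2] by force+
  have "degree (iterpoly \<nu> (Suc n)) = degree (?F\<^sup>2)"
    using sq(1) degree_add_eq_left[of "- [:\<nu>:]" "?F\<^sup>2"]
    by (simp del: minus_pCons)
  then show ?case using sq by (auto simp: coeff_pCons split: nat.splits)
qed simp

lemma degree_iterpoly [simp]: "degree (iterpoly \<nu> n) = 2 ^ n"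
  and lead_coeff_iterpoly: "coeff (iterpoly \<nu> n) (2 ^ n) = 1"
  using iterpoly_monic[of \<nu> n] by auto

lemma iterpoly_nonzero [simp]: "iterpoly \<nu> n \<noteq> 0"
  using lead_coeff_iterpoly[of \<nu> n] by auto

lemma content_iterpoly: "content (iterpoly \<nu> n) = 1"
  using content_dvd_coeff[of "iterpoly \<nu> n" "2 ^ n"]
  by (metis is_unit_content_iff lead_coeff_iterpoly)

text \<open>From \<open>n\<close> = 1 on the iterates are polynomials in t^2; only the vanishing of
  the linear coefficient is recorded. It makes C_j a multiple of x_j^2, and in the converse it
  controls the coefficient of t in multiples of the iterate.\<close>

lemma iterpoly_even:
  assumes "n \<ge> 1"
  obtains h where "iterpoly \<nu> n = [:crit \<nu> n:] + [:0, 0, 1:] * h"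
proof -
  have "\<exists>h. iterpoly \<nu> n = [:crit \<nu> n:] + [:0, 0, 1:] * h" using assms
  proof (induction n rule: dec_induct)
    case base
    show ?case by (rule exI[of _ 1]) (simp add: power2_eq_square)
  next
    case (step n)
    then obtain h where h: "iterpoly \<nu> n = [:crit \<nu> n:] + [:0, 0, 1:] * h" by blast
    define c where "c = crit \<nu> n"
    have "iterpoly \<nu> (Suc n) = ([:c:] + [:0, 0, 1:] * h)\<^sup>2 - [:\<nu>:]"
      using h by (simp add: c_def)
    also have "\<dots> = ([:c:]\<^sup>2 - [:\<nu>:]) + [:0, 0, 1:] * (2 * [:c:] * h + [:0, 0, 1:] * h\<^sup>2)"
      by (simp only: power2_eq_square algebra_simps mult_2)
    also have "[:c:]\<^sup>2 - [:\<nu>:] = [:crit \<nu> (Suc n):]"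
      by (simp add: c_def power2_eq_square)
    finally show ?case by blast
  qed
  then show thesis using that by blast
qed

text \<open>Squaring is additive modulo 2, so the terms strictly between the leading and the
  constant one stay even, as Eisenstein's criterion requires.\<close>

lemma iterpoly_mod_2: "\<exists>a s. iterpoly \<nu> n = monom 1 (2 ^ n) + [:a:] + smult 2 s"
proof (induction n)
  case 0
  show ?case by (rule exI[of _ 0], rule exI[of _ 0]) (simp add: monom_altdef)
next
  case (Suc n)
  then obtain a s where s: "iterpoly \<nu> n = monom 1 (2 ^ n) + [:a:] + smult 2 s" by blast
  let ?m = "monom 1 (2 ^ n) :: int poly"
  have "iterpoly \<nu> (Suc n) = (?m + [:a:] + smult 2 s)\<^sup>2 - [:\<nu>:]" using s by simp
  also have "smult 2 s = s + s" by (intro poly_eqI) (simp only: coeff_smult coeff_add mult_2)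
  also have "(?m + [:a:] + (s + s))\<^sup>2 - [:\<nu>:] = ?m\<^sup>2 + ([:a:]\<^sup>2 - [:\<nu>:])
      + (2 * (?m * [:a:]) + 4 * (?m * s + [:a:] * s + s\<^sup>2))"
    by (simp add: power2_eq_square algebra_simps)
  also have "2 * (?m * [:a:]) + 4 * (?m * s + [:a:] * s + s\<^sup>2)
      = smult 2 (?m * [:a:] + 2 * (?m * s + [:a:] * s + s\<^sup>2))"
    by (simp only: numeral_poly smult_add_right mult_pCons_left smult_smult mult_zero_left
        pCons_0_0 add_0_right) simp
  also have "?m\<^sup>2 = monom 1 (2 ^ Suc n)" by (simp add: monom_power mult.commute)
  also have "[:a:]\<^sup>2 - [:\<nu>:] = [:a\<^sup>2 - \<nu>:]" by (simp add: power2_eq_square)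
  finally show ?case by blast
qed

lemma crit_mod_4:
  assumes "\<nu> mod 4 = 2 \<or> \<nu> mod 4 = 3" and "even n" "n > 0"
  shows "crit \<nu> n mod 4 = 2"
proof -
  have sq: "(k\<^sup>2 - \<nu>) mod 4 = ((k mod 4)\<^sup>2 - \<nu> mod 4) mod 4" for k :: int
  proof -
    have "(k\<^sup>2 - \<nu>) mod 4 = (k\<^sup>2 mod 4 - \<nu> mod 4) mod 4" by (rule mod_diff_eq[symmetric])
    also have "k\<^sup>2 mod 4 = (k mod 4)\<^sup>2 mod 4" by (rule power_mod[symmetric])
    finally show ?thesis by (simp only: mod_diff_left_eq)
  qed
  \<comment> \<open>A value 0 or 2 has square 0 modulo 4, so one step gives -\<open>\<nu>\<close>
    and two steps give \<open>\<nu>\<close>^2 - \<open>\<nu>\<close>, which is 2 modulo 4 for both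
    residues of \<open>\<nu>\<close>. The intermediate value is odd when \<open>\<nu>\<close> is 3
    modulo 4, hence the restriction to even \<open>n\<close>.\<close>
  have step: "crit \<nu> (Suc (Suc m)) mod 4 = 2" if "crit \<nu> m mod 4 = 0 \<or> crit \<nu> m mod 4 = 2" for m
  proof -
    have "(crit \<nu> (Suc m)) mod 4 = ((crit \<nu> m mod 4)\<^sup>2 - \<nu> mod 4) mod 4"
      using sq[of "crit \<nu> m"] by simp
    moreover have "(crit \<nu> (Suc (Suc m))) mod 4 = ((crit \<nu> (Suc m) mod 4)\<^sup>2 - \<nu> mod 4) mod 4"
      using sq[of "crit \<nu> (Suc m)"] by simp
    ultimately show ?thesis using that assms(1) by auto
  qed
  have "crit \<nu> (2 * Suc m) mod 4 = 2" for m
  proof (induction m)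
    case 0
    show ?case using step[of 0] by (simp add: numeral_2_eq_2)
  next
    case (Suc m)
    then show ?case using step[of "2 * Suc m"] by simp
  qed
  moreover obtain m where "n = 2 * Suc m"
  proof -
    obtain k where "n = 2 * k" using assms(2) by (rule evenE)
    then show thesis using that[of "k - 1"] assms(3) by simp
  qed
  ultimately show ?thesis by blast
qed

lemma iterpoly_even_irreducible:
  assumes \<nu>: "\<nu> mod 4 = 2 \<or> \<nu> mod 4 = 3" and n: "even n" "n > 0" and gh: "iterpoly \<nu> n = g * h"
  shows "degree g = 0 \<or> degree h = 0"
proof (rule eisenstein_criterion[OF _ gh])
  obtain a s where s: "iterpoly \<nu> n = monom 1 (2 ^ n) + [:a:] + smult 2 s"
    using iterpoly_mod_2 by blast
  have c: "coeff (iterpoly \<nu> n) 0 mod 4 = 2"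
    using crit_mod_4[OF \<nu> n] by (simp add: poly_0_coeff_0)
  then show "\<not> 2\<^sup>2 dvd coeff (iterpoly \<nu> n) 0" by auto
  have "coeff (iterpoly \<nu> n) 0 = a + 2 * coeff s 0" using s by simp
  then have "2 dvd a" using c by presburger
  then show "2 dvd coeff (iterpoly \<nu> n) i" if "i < degree (iterpoly \<nu> n)" for i
    using that unfolding degree_iterpoly by (subst s) (auto simp: coeff_pCons split: nat.splits)
  show "\<not> 2 dvd lead_coeff (iterpoly \<nu> n)" using iterpoly_monic[of \<nu> n] by simp
qed simp_all

section \<open>The nested radicals and their minimal polynomials\<close>

lemma xseq_nonneg: "\<nu> \<ge> 0 \<Longrightarrow> xseq \<nu> n \<ge> 0"
  by (induction n) auto

lemma xseq_square: "\<nu> \<ge> 0 \<Longrightarrow> (xseq \<nu> (Suc n))\<^sup>2 = xseq \<nu> n + of_int \<nu>"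
  using xseq_nonneg[of \<nu> n] by simp

lemma ipoly_iterpoly_xseq: "\<nu> \<ge> 0 \<Longrightarrow> ipoly (iterpoly \<nu> k) (xseq \<nu> (n + k)) = xseq \<nu> n"
proof (induction k arbitrary: n)
  case (Suc k)
  from Suc.IH[of "Suc n"] Suc.prems xseq_square[of \<nu> n] show ?case by simp
qed simp

lemma iterpoly_root: "\<nu> \<ge> 0 \<Longrightarrow> ipoly (iterpoly \<nu> n) (xseq \<nu> n) = 0"
  using ipoly_iterpoly_xseq[of \<nu> n 0] by simp

text \<open>For even \<open>n\<close> > 0 this is Eisenstein irreducibility. If \<open>q\<close>
  vanishes at x_n, then \<open>q\<close> composed with t^2 - \<open>\<nu>\<close> vanishes at
  x_(n+1) and has twice the degree, so the bound descends from \<open>n\<close> + 1 to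
  \<open>n\<close>.\<close>

lemma degree_ge_if_root_xseq:
  assumes \<nu>: "\<nu> \<ge> 0" "\<nu> mod 4 = 2 \<or> \<nu> mod 4 = 3"
    and q: "q \<noteq> 0" "ipoly q (xseq \<nu> n) = 0"
  shows "2 ^ n \<le> degree q"
proof -
  have ev: "2 ^ n \<le> degree q" if "even n" "n > 0" "q \<noteq> 0" "ipoly q (xseq \<nu> n) = 0" for q n
    using degree_le_if_root_of_irreducible[OF content_iterpoly iterpoly_root[OF \<nu>(1)]
        iterpoly_even_irreducible[OF \<nu>(2) that(1,2)] that(3,4)]
    by simp
  have down: "2 ^ n \<le> degree q"
    if up: "\<And>q. q \<noteq> 0 \<Longrightarrow> ipoly q (xseq \<nu> (Suc n)) = 0 \<Longrightarrow> 2 ^ Suc n \<le> degree q"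
      and q: "q \<noteq> 0" "ipoly q (xseq \<nu> n) = 0" for q n
  proof -
    let ?r = "pcompose q [:- \<nu>, 0, 1:]"
    have "ipoly [:- \<nu>, 0, 1:] (xseq \<nu> (Suc n)) = xseq \<nu> n"
      using xseq_square[OF \<nu>(1), of n] by (simp add: power2_eq_square algebra_simps del: xseq.simps)
    then have "ipoly ?r (xseq \<nu> (Suc n)) = 0"
      using q(2) by (simp only: ipoly_pcompose)
    moreover have "?r \<noteq> 0" using q(1) by (auto simp: pcompose_eq_0_iff)
    ultimately have "2 ^ Suc n \<le> degree ?r" by (rule up[rotated])
    then show ?thesis by (simp add: degree_pcompose)
  qed
  have odd: "2 ^ n \<le> degree q" if "odd n" "q \<noteq> 0" "ipoly q (xseq \<nu> n) = 0" for q n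
    by (rule down[OF ev that(2,3)]) (use that(1) in auto)
  show ?thesis
  proof (cases "even n")
    case True
    \<comment> \<open>Descending twice, from \<open>n\<close> + 2 through the odd index
      \<open>n\<close> + 1, also covers \<open>n\<close> = 0.\<close>
    show ?thesis by (rule down[OF odd q]) (use True in auto)
  qed (use odd q in blast)
qed

lemma clear_denominators:
  fixes q :: "rat poly"
  obtains d :: int and r :: "int poly" where "d \<noteq> 0" "map_poly of_int r = smult (of_int d) q"
proof -
  have "\<exists>d r. d \<noteq> 0 \<and> map_poly of_int r = smult (of_int d) q"
  proof (induction q)
    case 0
    show ?case by (intro exI[of _ 1] exI[of _ 0]) simp
  next
    case (pCons a q)
    then obtain d r where dr: "d \<noteq> 0" "map_poly of_int r = smult (of_int d) q" by blast
    obtain k b where kb: "quotient_of a = (k, b)" by force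
    then have b: "b > 0" "a = of_int k / of_int b"
      using quotient_of_denom_pos quotient_of_div by blast+
    have "map_poly of_int (pCons (d * k) (smult b r)) = smult (of_int (d * b)) (pCons a q)"
      using b dr by (intro poly_eqI)
        (auto simp: coeff_map_poly coeff_pCons poly_eq_iff split: nat.splits)
    moreover have "d * b \<noteq> 0" using dr b by simp
    ultimately show ?case by blast
  qed
  then show thesis using that by blast
qed

lemma coeff_iterpoly_0: "coeff (iterpoly \<nu> n) 0 = crit \<nu> n"
  by (simp add: poly_0_coeff_0)

text \<open>Clearing denominators carries the degree bound over to rational polynomials. Two monic
  polynomials of the least degree vanishing at x_n differ by one of smaller degree that still
  vanishes there, hence by 0.\<close>

lemma minpoly_Q_xseq:
  assumes \<nu>: "\<nu> \<ge> 0" "\<nu> mod 4 = 2 \<or> \<nu> mod 4 = 3"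
  shows "minpoly_Q (xseq \<nu> n) = map_poly of_int (iterpoly \<nu> n)"
proof -
  let ?x = "xseq \<nu> n" and ?F = "map_poly of_int (iterpoly \<nu> n) :: rat poly"
  have comp: "poly (map_poly of_rat (map_poly of_int r)) ?x = ipoly r ?x" for r
    by (simp add: map_poly_map_poly o_def)
  have F: "degree ?F = 2 ^ n" "lead_coeff ?F = 1" "poly (map_poly of_rat ?F) ?x = 0"
    by (simp_all add: degree_map_poly coeff_map_poly lead_coeff_iterpoly comp iterpoly_root[OF \<nu>(1)])
  have low: "2 ^ n \<le> degree q" if q: "q \<noteq> 0" "poly (map_poly of_rat q) ?x = 0" for q
  proof -
    obtain d r where dr: "d \<noteq> 0" "map_poly of_int r = smult (of_int d) q"
      by (rule clear_denominators)
    have "degree q = degree (map_poly of_int r :: rat poly)" using dr by simp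
    also have "\<dots> = degree r" by (simp add: degree_map_poly)
    finally have deg: "degree q = degree r" .
    have "ipoly r ?x = 0"
      unfolding comp[symmetric] dr(2) using q(2) by (simp add: map_poly_smult of_rat_mult)
    moreover have "r \<noteq> 0" using dr q(1) by auto
    ultimately show ?thesis unfolding deg using degree_ge_if_root_xseq[OF \<nu>] by blast
  qed
  show ?thesis
    unfolding minpoly_Q_def
  proof (rule the_equality)
    show "lead_coeff ?F = 1 \<and> poly (map_poly of_rat ?F) ?x = 0 \<and>
      (\<forall>q. q \<noteq> 0 \<longrightarrow> poly (map_poly of_rat q) ?x = 0 \<longrightarrow> degree ?F \<le> degree q)"
      using F low by simp
    fix m :: "rat poly"
    assume m: "lead_coeff m = 1 \<and> poly (map_poly of_rat m) ?x = 0 \<and>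
      (\<forall>q. q \<noteq> 0 \<longrightarrow> poly (map_poly of_rat q) ?x = 0 \<longrightarrow> degree m \<le> degree q)"
    have "?F \<noteq> 0" using F(2) by auto
    then have "degree m \<le> 2 ^ n" using m F by metis
    moreover have "m \<noteq> 0" using m by auto
    ultimately have deg: "degree m = 2 ^ n" using low m by (meson le_antisym)
    show "m = ?F"
    proof (rule ccontr)
      assume "m \<noteq> ?F"
      then have ne: "m - ?F \<noteq> 0" by simp
      have "map_poly of_rat (m - ?F) = map_poly of_rat m - (map_poly of_rat ?F :: real poly)"
        by (intro poly_eqI) (simp add: coeff_map_poly of_rat_diff)
      then have "poly (map_poly of_rat (m - ?F)) ?x = 0" using m F(3) by simp
      then have "2 ^ n \<le> degree (m - ?F)" using low ne by blast
      moreover have "degree (m - ?F) \<le> 2 ^ n" by (rule degree_diff_le) (use deg F(1) in simp_all)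
      ultimately have "degree (m - ?F) = 2 ^ n" by simp
      moreover have "coeff (m - ?F) (2 ^ n) = 0" using m F deg by simp
      ultimately show False using ne by (metis leading_coeff_0_iff)
    qed
  qed
qed

lemma Cn_eq_crit:
  assumes "\<nu> \<ge> 0" "\<nu> mod 4 = 2 \<or> \<nu> mod 4 = 3"
  shows "Cn \<nu> n = crit \<nu> n"
  unfolding Cn_def minpoly_Q_xseq[OF assms]
  by (rule the_equality) (auto simp: coeff_map_poly coeff_iterpoly_0)

text \<open>From \<open>p\<close> dividing C_m it follows that \<open>p\<^sup>2\<close> divides
  C_m^2, so C_(m+1) and C_1 agree modulo \<open>p\<^sup>2\<close> and the orbit has period
  \<open>m\<close> there from index 1 on. Subtracting \<open>m\<close> from \<open>j\<close>
  repeatedly leads down to \<open>m\<close>.\<close>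

lemma square_not_dvd_crit:
  fixes p :: int
  assumes m: "m \<ge> 1" "p dvd crit \<nu> m" "\<not> p\<^sup>2 dvd crit \<nu> m"
    and least: "\<And>j. 1 \<le> j \<Longrightarrow> p dvd crit \<nu> j \<Longrightarrow> m \<le> j"
    and j: "j \<ge> 1" "p dvd crit \<nu> j"
  shows "\<not> p\<^sup>2 dvd crit \<nu> j"
  using j
proof (induction j rule: less_induct)
  case (less j)
  have per: "p\<^sup>2 dvd crit \<nu> (m + Suc i) - crit \<nu> (Suc i)" for i
  proof (induction i)
    case 0
    show ?case using m(2) by (simp add: dvd_power_same)
  next
    case (Suc i)
    have "crit \<nu> (m + Suc (Suc i)) - crit \<nu> (Suc (Suc i))
        = (crit \<nu> (m + Suc i) - crit \<nu> (Suc i)) * (crit \<nu> (m + Suc i) + crit \<nu> (Suc i))"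
      by (simp add: power2_eq_square algebra_simps)
    then show ?case using Suc by (metis dvd_mult2)
  qed
  have "m \<le> j" using least less.prems by blast
  show ?case
  proof (cases "j = m")
    case False
    with \<open>m \<le> j\<close> obtain i where i: "j = m + Suc i"
      by (metis add_Suc_right le_neq_implies_less less_imp_Suc_add)
    have "p dvd crit \<nu> (m + Suc i) - crit \<nu> (Suc i)"
      using per[of i] by (metis dvd_mult_left power2_eq_square)
    then have "p dvd crit \<nu> (Suc i)"
      using less.prems(2) i by (metis dvd_diff_commute dvd_diff_right_iff)
    then have "\<not> p\<^sup>2 dvd crit \<nu> (Suc i)" using less.IH[of "Suc i"] i m(1) by simp
    then show ?thesis using per[of i] i by (metis dvd_diff_commute dvd_diff_right_iff)
  qed (use m in simp)
qed

section \<open>The ring Z[x_n]\<close>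

lemma ipoly_mem_Zadj: "ipoly q x \<in> Zadj x"
  by (auto simp: Zadj_def)

lemma ZadjE:
  assumes "a \<in> Zadj x"
  obtains q where "a = ipoly q x"
  using assms by (auto simp: Zadj_def)

lemma real_subring_Zadj: "real_subring (Zadj x)"
proof
  show "1 \<in> Zadj x" using ipoly_mem_Zadj[of 1 x] by simp
  fix a b assume "a \<in> Zadj x" "b \<in> Zadj x"
  then obtain q r where "a = ipoly q x" "b = ipoly r x" by (elim ZadjE)
  then show "a - b \<in> Zadj x" "a * b \<in> Zadj x"
    using ipoly_mem_Zadj[of "q - r" x] ipoly_mem_Zadj[of "q * r" x] by simp_all
qed

locale xseq_ring =
  fixes \<nu> :: int and n :: nat
  assumes nu_nonneg: "\<nu> \<ge> 0" and nu_mod_4: "\<nu> mod 4 = 2 \<or> \<nu> mod 4 = 3"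
begin

abbreviation "F \<equiv> iterpoly \<nu> n"
abbreviation "x \<equiv> xseq \<nu> n"
abbreviation "A \<equiv> Zadj x"

lemma F_root: "ipoly F x = 0"
  by (rule iterpoly_root[OF nu_nonneg])

lemma division_by_F:
  obtains r s where "q = F * s + r" "r = 0 \<or> degree r < 2 ^ n"
proof -
  have "lead_coeff F = 1" by (simp add: lead_coeff_iterpoly)
  then obtain s r where "q = F * s + r" "r = 0 \<or> degree r < degree F"
    by (rule monic_division[of F q])
  then show thesis using that[of s r] by simp
qed

text \<open>The remainder on division by the monic \<open>F\<close> vanishes at x_n and has degree
  below 2^n, so it is 0. Thus Z[x_n] is Z[t]/(F), and relations in it can be tested on
  coefficients.\<close>

lemma root_multiple:
  assumes "ipoly q x = 0"
  obtains s where "q = F * s"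
proof -
  obtain r s where rs: "q = F * s + r" "r = 0 \<or> degree r < 2 ^ n" by (rule division_by_F)
  then have "ipoly r x = 0" using assms F_root by simp
  then have "r = 0"
    using degree_ge_if_root_xseq[OF nu_nonneg nu_mod_4, of r n] rs(2) by fastforce
  then show thesis using that rs(1) by simp
qed

text \<open>A nonzero member of least degree of the ideal (q, F) of Z[t], described by
  \<open>S\<close>, turns out to be constant; evaluating it at x_n gives the integer.\<close>

lemma integer_multiple:
  assumes "ipoly q x \<noteq> 0"
  obtains N s where "N \<noteq> 0" "of_int N = ipoly q x * ipoly s x"
proof -
  define S where "S r \<longleftrightarrow> r \<noteq> 0 \<and> (\<exists>s w. r = q * s + F * w)" for r
  have "S F" unfolding S_def by (intro conjI exI[of _ 0] exI[of _ 1]) auto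
  define N where "N = (LEAST k. \<exists>r. S r \<and> degree r = k)"
  have "\<exists>r. S r \<and> degree r = N"
    unfolding N_def by (rule LeastI_ex) (use \<open>S F\<close> in blast)
  then obtain r where r: "S r" "degree r = N" by blast
  have minimal: "N \<le> degree t" if "S t" for t
    unfolding N_def by (rule Least_le) (use that in blast)
  obtain s w where sw: "r = q * s + F * w" and r0: "r \<noteq> 0" using r(1) by (auto simp: S_def)
  \<comment> \<open>Minimality of its degree makes \<open>r\<close> divide a nonzero integer
    multiple of each member of the ideal, in particular of \<open>q\<close> and
    \<open>F\<close>.\<close>
  have div: "\<exists>c b. c \<noteq> 0 \<and> smult c t = r * b" if t: "\<exists>s w. t = q * s + F * w" for t
  proof -
    obtain c b where cb: "c \<noteq> 0" "smult c t = r * b + pseudo_mod t r"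
      using pseudo_mod(1)[OF r0] by blast
    obtain s' w' where "t = q * s' + F * w'" using t by blast
    then have "pseudo_mod t r = q * (smult c s' - s * b) + F * (smult c w' - w * b)"
      using cb(2) sw by (simp add: algebra_simps smult_add_right)
    then have "pseudo_mod t r = 0"
      using minimal[of "pseudo_mod t r"] pseudo_mod(2)[OF r0, of t] r(2)
      unfolding S_def by fastforce
    then show ?thesis using cb by auto
  qed
  have "\<exists>s w. q = q * s + F * w" by (intro exI[of _ 1] exI[of _ 0]) simp
  then obtain c b where cb: "c \<noteq> 0" "smult c q = r * b" using div by blast
  have "\<exists>s w. F = q * s + F * w" by (intro exI[of _ 0] exI[of _ 1]) simp
  then obtain c' b' where cb': "c' \<noteq> 0" "smult c' F = r * b'" using div by blast
  \<comment> \<open>As \<open>r\<close> divides a multiple of \<open>q\<close>, it does not vanish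
    at x_n, so the cofactor \<open>b'\<close> of \<open>F\<close> does. Then \<open>b'\<close> takes
    up the whole degree 2^n, and degree 0 is left for \<open>r\<close>.\<close>
  have rx: "ipoly r x \<noteq> 0"
    using arg_cong[OF cb(2), of "\<lambda>t. ipoly t x"] cb(1) assms by auto
  then have "ipoly b' x = 0"
    using arg_cong[OF cb'(2), of "\<lambda>t. ipoly t x"] F_root by simp
  moreover have b'0: "b' \<noteq> 0" using cb' by auto
  ultimately have "2 ^ n \<le> degree b'"
    using degree_ge_if_root_xseq[OF nu_nonneg nu_mod_4] by blast
  moreover have "2 ^ n = degree r + degree b'"
    using arg_cong[OF cb'(2), of degree] cb'(1) r0 b'0 by (simp add: degree_mult_eq)
  ultimately have "degree r = 0" by simp
  then obtain N where N: "r = [:N:]" by (rule degree_eq_zeroE)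
  then have "of_int N = ipoly r x" by simp
  also have "\<dots> = ipoly q x * ipoly s x" using sw F_root by simp
  finally show thesis using that[of N s] N r0 by auto
qed

text \<open>Pigeonhole in the finite ring Z[x_n]/p: each power of \<open>a\<close> is represented by
  a polynomial of degree below 2^n, and \<open>f\<close> lists its coefficients modulo
  \<open>p\<close>.\<close>

lemma power_congruence:
  assumes "a \<in> A" "p > 0"
  obtains i j b where "i < j" "b \<in> A" "a ^ i - a ^ j = of_int p * b"
proof -
  interpret real_subring A by (rule real_subring_Zadj)
  have "\<exists>q. a ^ k = ipoly q x \<and> (q = 0 \<or> degree q < 2 ^ n)" for k
  proof -
    obtain q where q: "a ^ k = ipoly q x" using power_mem[OF assms(1)] by (rule ZadjE)
    obtain r s where "q = F * s + r" "r = 0 \<or> degree r < 2 ^ n" by (rule division_by_F)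
    then show ?thesis using q F_root by auto
  qed
  then obtain Q where Q: "a ^ k = ipoly (Q k) x" "Q k = 0 \<or> degree (Q k) < 2 ^ n" for k
    by metis
  define f where "f k = map (\<lambda>i. coeff (Q k) i mod p) [0..<2 ^ n]" for k
  have "range f \<subseteq> {xs. set xs \<subseteq> {0..<p} \<and> length xs = 2 ^ n}"
    using assms(2) by (auto simp: f_def)
  then have "finite (range f)"
    using finite_lists_length_eq[of "{0..<p}" "2 ^ n"] finite_subset by blast
  then have "\<not> inj f" using finite_imageD by blast
  then obtain i j where ij: "i < j" "f i = f j"
    unfolding inj_def by (metis linorder_neqE_nat)
  have "p dvd coeff (Q i - Q j) k" for k
  proof (cases "k < 2 ^ n")
    case True
    then have "f i ! k = f j ! k" using ij by simp
    then show ?thesis using True by (simp add: f_def mod_eq_dvd_iff)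
  next
    case False
    then have "coeff (Q i) k = 0" "coeff (Q j) k = 0"
      using Q(2)[of i] Q(2)[of j] by (auto intro: coeff_eq_0)
    then show ?thesis by simp
  qed
  then have "[:p:] dvd Q i - Q j" by (simp add: const_poly_dvd_iff)
  then obtain b where "Q i - Q j = [:p:] * b" by blast
  then have "ipoly (Q i - Q j) x = ipoly ([:p:] * b) x" by (simp only:)
  then have "a ^ i - a ^ j = of_int p * ipoly b x" using Q(1) by simp
  then show thesis using that ij(1) ipoly_mem_Zadj by blast
qed

end

section \<open>Primes above $p$\<close>

locale xseq_prime = xseq_ring + real_prime_ideal "Zadj (xseq \<nu> n)" P for P +
  fixes p :: int
  assumes prime_p: "prime p" and P_int: "\<And>k. of_int k \<in> P \<longleftrightarrow> p dvd k"
begin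

lemma p_mem: "of_int p \<in> P"
  by (simp add: P_int)

lemma p_pos: "p > 0"
  using prime_p by (rule prime_gt_0_int)

text \<open>Since $\mathbb{Z}[x_n]/p$ is finite, some power of $\pi$ is locally a multiple of $p$, and
  every nonzero element divides a nonzero integer; this replaces Krull's intersection theorem.\<close>

lemma not_arbitrarily_divisible:
  assumes pi: "\<pi> \<in> P" and a: "a \<in> A" "a \<noteq> 0"
  shows "\<exists>k. \<forall>l\<in>loc. a \<noteq> \<pi> ^ k * l"
proof -
  obtain q where q: "a = ipoly q x" using a(1) by (rule ZadjE)
  then obtain N s where N: "N \<noteq> 0" "of_int N = a * ipoly s x"
    using integer_multiple[of q] a(2) by metis
  obtain N' where N': "N = p ^ multiplicity p N * N'" "\<not> p dvd N'"
    using multiplicity_decompose'[of N p] N(1) prime_p by (metis not_prime_unit)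
  define v where "v = multiplicity p N"
  have piA: "\<pi> \<in> A" using pi P_subset by auto
  obtain i j b where ij: "i < j" "b \<in> A" "\<pi> ^ i - \<pi> ^ j = of_int p * b"
    by (rule power_congruence[OF piA p_pos])
  \<comment> \<open>Since \<open>\<pi>\<close> lies in P, \<open>e\<close> is a unit of the
    localization, so the congruence of powers makes \<open>\<pi> ^ i\<close> a local multiple of
    \<open>p\<close>.\<close>
  define e where "e = 1 - \<pi> ^ (j - i)"
  have "\<pi> ^ (j - i) = \<pi> ^ (j - Suc i) * \<pi>"
    using ij(1) by (metis Suc_diff_Suc power_Suc2)
  then have "\<pi> ^ (j - i) \<in> P" using P_mult[OF pi power_mem[OF piA]] by simp
  then have e: "e \<in> A" "e \<notin> P"
    using one_notin_P P_add[of e "\<pi> ^ (j - i)"] P_subset by (auto simp: e_def intro: diff_mem one_mem)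
  have e0: "e \<noteq> 0" using e(2) P_zero by auto
  have "\<pi> ^ i * e = \<pi> ^ i - \<pi> ^ j"
    using ij(1) by (simp add: e_def algebra_simps flip: power_add)
  then have pii: "\<pi> ^ i = of_int p * (b / e)" using ij(3) e0 by (simp add: field_simps)
  have be: "b / e \<in> loc" using ij(2) e by (intro locI)
  \<comment> \<open>This exponent makes \<open>p ^ Suc v\<close> divide \<open>N\<close> locally,
    one power more than its \<open>p\<close>-adic valuation \<open>v\<close> allows: cancelling
    \<open>p ^ v\<close> would put the part \<open>N'\<close> prime to \<open>p\<close> into
    P.\<close>
  have "a \<noteq> \<pi> ^ (i * Suc v) * l" if l: "l \<in> loc" for l
  proof
    assume al: "a = \<pi> ^ (i * Suc v) * l"
    define K where "K = (b / e) ^ Suc v * l * ipoly s x"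
    from al have "of_int N = of_int p ^ Suc v * K"
      using N(2) unfolding K_def by (simp only: power_mult pii power_mult_distrib mult.assoc)
    moreover have "real_of_int N = of_int p ^ v * of_int N'"
      using N'(1) by (simp only: v_def[symmetric] of_int_mult of_int_power)
    ultimately have N'p: "of_int N' = of_int p * K"
      using p_pos by simp
    have "K \<in> loc"
      unfolding K_def using l be A_loc[OF ipoly_mem_Zadj] by (intro loc.mult_mem loc.power_mem)
    then obtain c d where cd: "K = c / d" "c \<in> A" "d \<in> A" "d \<notin> P" "d \<noteq> 0" by (rule locE)
    then have "of_int N' * d = of_int p * c" using N'p by simp
    then have "of_int N' * d \<in> P" using P_mult_right[OF p_mem cd(2)] by simp
    then have "of_int N' \<in> P" using P_primeD[OF of_int_mem cd(3)] cd(4) by blast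
    then show False using N'(2) P_int by simp
  qed
  then show ?thesis by blast
qed

text \<open>A monic \<open>g\<close> of least degree in the preimage of P in Z[t] reduces modulo
  \<open>p\<close> to a generator of the image of that preimage in F_p[t]. \<open>F\<close> shows
  that the preimage contains a monic polynomial.\<close>

lemma two_generators:
  obtains g where "ipoly g x \<in> P"
    "\<forall>q. ipoly q x \<in> P \<longrightarrow> (\<exists>s r. q = g * s + smult p r)"
proof -
  define S where "S g \<longleftrightarrow> lead_coeff g = 1 \<and> ipoly g x \<in> P" for g
  define N where "N = (LEAST k. \<exists>g. S g \<and> degree g = k)"
  have "S F" using F_root P_zero by (simp add: S_def lead_coeff_iterpoly)
  have "\<exists>g. S g \<and> degree g = N"
    unfolding N_def by (rule LeastI_ex) (use \<open>S F\<close> in blast)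
  then obtain g where g: "lead_coeff g = 1" "ipoly g x \<in> P" "degree g = N"
    by (auto simp: S_def)
  have minimal: "N \<le> degree t" if "lead_coeff t = 1" "ipoly t x \<in> P" for t
    unfolding N_def by (rule Least_le) (use that S_def in blast)
  have small: "\<exists>r. t = smult p r" if "degree t < N" "ipoly t x \<in> P" for t
    using that
  \<comment> \<open>a leading coefficient prime to $p$ could be made 1, contradicting minimality of $g$\<close>
  proof (induction "if t = 0 then 0 else Suc (degree t)" arbitrary: t rule: less_induct)
    case less
    show ?case
    proof (cases "t = 0")
      case False
      define d where "d = degree t"
      define c where "c = coeff t d"
      have "p dvd c"
      proof (rule ccontr)
        assume "\<not> p dvd c"
        then have "coprime c p" using prime_p by (metis coprime_commute prime_imp_coprime)
        then obtain u v where uv: "u * c + v * p = 1"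
          using bezout_int[of c p] by (auto simp: coprime_iff_gcd_eq_1)
        \<comment> \<open>The Bezout identity is exactly the statement that the coefficient of t^d
          becomes 1; the added multiple of \<open>p\<close> does not leave P.\<close>
        define t' where "t' = smult u t + smult p (monom v d)"
        have c1: "coeff t' d = 1" using uv by (simp add: t'_def c_def mult.commute)
        have "degree t' \<le> d"
          unfolding t'_def by (intro degree_add_le) (auto simp: d_def degree_monom_le)
        moreover have "d \<le> degree t'" using c1 by (intro le_degree) simp
        ultimately have "degree t' = d" by simp
        moreover have "ipoly t' x \<in> P"
          unfolding t'_def ipoly_simps using less.prems(2)
          by (intro P_add P_mult[OF _ of_int_mem] P_mult_right[OF p_mem] ipoly_mem_Zadj)
        ultimately show False using minimal[of t'] c1 less.prems(1) by (simp add: d_def)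
      qed
      then obtain c' where c': "c = p * c'" by blast
      define t' where "t' = t - smult p (monom c' d)"
      have "coeff t' d = 0" using c' by (simp add: t'_def c_def)
      have "degree t' \<le> d"
        unfolding t'_def by (intro degree_diff_le) (auto simp: d_def degree_monom_le)
      then have t': "t' = 0 \<or> degree t' < d"
        using \<open>coeff t' d = 0\<close> by (metis leading_coeff_0_iff le_neq_implies_less)
      have "ipoly t' x \<in> P"
        unfolding t'_def ipoly_simps using less.prems(2)
        by (intro P_diff P_mult_right[OF p_mem] ipoly_mem_Zadj)
      moreover have "degree t' < N" using t' less.prems(1) by (auto simp: d_def)
      \<comment> \<open>Ranking 0 strictly below the nonzero constants makes this a decrease even
        when \<open>t\<close> is constant.\<close>
      moreover have "(if t' = 0 then 0 else Suc (degree t')) < (if t = 0 then 0 else Suc (degree t))"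
        using t' False by (auto simp: d_def)
      ultimately obtain r where "t' = smult p r" using less.hyps by blast
      then have "t = smult p (r + monom c' d)" by (simp add: t'_def smult_add_right algebra_simps)
      then show ?thesis by blast
    qed (auto intro: exI[of _ 0])
  qed
  have "\<exists>s r. q = g * s + smult p r" if q: "ipoly q x \<in> P" for q
  proof -
    obtain s t where st: "q = g * s + t" "t = 0 \<or> degree t < degree g"
      by (rule monic_division[OF g(1)])
    have "ipoly t x = ipoly q x - ipoly g x * ipoly s x" using st(1) by simp
    then have "ipoly t x \<in> P" using q P_mult_right[OF g(2) ipoly_mem_Zadj] P_diff by simp
    then have "\<exists>r. t = smult p r"
      using small[of t] st(2) g(3) by (auto intro: exI[of _ 0])
    then show ?thesis using st(1) by blast
  qed
  then show thesis using that g(2) by blast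
qed

text \<open>P is generated by \<open>p\<close> and g(x_n), so an element of P that divides both of
  them locally generates the maximal ideal of the localization.\<close>

lemma DVR_if_generator:
  assumes "ipoly g x \<in> P" "\<forall>q. ipoly q x \<in> P \<longrightarrow> (\<exists>s r. q = g * s + smult p r)"
    and "\<pi> \<in> P" "\<pi> \<noteq> 0" "l \<in> loc" "l' \<in> loc" "ipoly g x = \<pi> * l" "of_int p = \<pi> * l'"
  shows "DVR (real_ring loc)"
proof (rule DVR_loc)
  fix y assume y: "y \<in> P"
  then obtain q where q: "y = ipoly q x" using P_subset by (blast elim: ZadjE)
  then obtain s r where "q = g * s + smult p r" using assms(2) y by blast
  then have "y = ipoly g x * ipoly s x + of_int p * ipoly r x" using q by simp
  also have "\<dots> = \<pi> * (l * ipoly s x + l' * ipoly r x)"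
    unfolding assms(7,8) by (simp add: algebra_simps)
  finally show "\<exists>l\<in>loc. y = \<pi> * l"
    using assms(5,6) by (intro bexI[of _ "l * ipoly s x + l' * ipoly r x"] loc.add_mem
        loc.mult_mem A_loc[OF ipoly_mem_Zadj])
qed (use assms not_arbitrarily_divisible in auto)

text \<open>Locally \<open>s\<close> is a unit, so \<open>p\<close> lies in the square of the
  maximal ideal, and g(x_n) alone has to generate. The proof makes this Nakayama argument
  explicit.\<close>

lemma DVR_if_ramified:
  assumes w: "w \<in> P" and h: "h \<in> A" and s: "s \<in> A" "s \<notin> P"
    and eq: "of_int p * s = w\<^sup>2 * h"
  shows "DVR (real_ring loc)"
proof -
  obtain g where g: "ipoly g x \<in> P" "\<forall>q. ipoly q x \<in> P \<longrightarrow> (\<exists>s r. q = g * s + smult p r)"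
    by (rule two_generators)
  define G where "G = ipoly g x"
  obtain q where q: "w = ipoly q x" using w P_subset by (blast elim: ZadjE)
  then obtain b a where "q = g * b + smult p a" using g(2) w by blast
  then obtain \<alpha> \<beta> where ab: "w = G * \<beta> + of_int p * \<alpha>" "\<alpha> \<in> A" "\<beta> \<in> A"
    using q ipoly_mem_Zadj by (force simp: G_def)
  have G: "G \<in> P" "G \<in> A" using g(1) P_subset by (auto simp: G_def)
  have pA: "of_int p \<in> A" by (rule of_int_mem)
  \<comment> \<open>Expanding, \<open>w\<^sup>2 * h\<close> is
    \<open>G\<^sup>2 * (\<beta>\<^sup>2 * h)\<close> plus \<open>p\<close> times \<open>y\<close>.
    As \<open>y\<close> lies in P, \<open>s - y\<close> is still a local unit, and \<open>p\<close>
    becomes a local multiple of \<open>G\<close>.\<close>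
  define y where "y = G * (2 * \<alpha> * \<beta> * h) + of_int p * (\<alpha>\<^sup>2 * h)"
  have two: "(2::real) \<in> A" using of_int_mem[of 2] by simp
  have y: "y \<in> P"
    unfolding y_def using G p_mem ab h two
    by (intro P_add P_mult_right mult_mem power_mem)
  define e where "e = s - y"
  have e: "e \<in> A" "e \<notin> P"
    using s y P_subset P_add[of e y] by (auto simp: e_def intro: diff_mem)
  then have e0: "e \<noteq> 0" using P_zero by auto
  have "of_int p * e = G\<^sup>2 * (\<beta>\<^sup>2 * h)"
    using eq unfolding e_def y_def ab(1) by (simp add: power2_eq_square algebra_simps)
  then have p: "of_int p = G * (G * (\<beta>\<^sup>2 * h) / e)"
    using e0 by (simp add: field_simps power2_eq_square)
  have G0: "G \<noteq> 0" using p p_pos by auto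
  have l: "G * (\<beta>\<^sup>2 * h) / e \<in> loc"
    using G ab h e by (intro locI mult_mem power_mem)
  show ?thesis
    by (rule DVR_if_generator[OF g G(1) G0 loc.one_mem l _ p]) (simp add: G_def)
qed

text \<open>Write \<open>F\<close> = g h + p r. If h(x_n) were in P, the product rule would put
  F'(x_n) into P. So h(x_n) is a local unit, g(x_n) is a local multiple of \<open>p\<close>, and
  \<open>p\<close> is a uniformizer.\<close>

lemma DVR_if_unramified:
  assumes "ipoly (pderiv F) x \<notin> P"
  shows "DVR (real_ring loc)"
proof -
  obtain g where g: "ipoly g x \<in> P" "\<forall>q. ipoly q x \<in> P \<longrightarrow> (\<exists>s r. q = g * s + smult p r)"
    by (rule two_generators)
  obtain h r where hr: "F = g * h + smult p r" using g(2) F_root P_zero by metis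
  have der: "ipoly (pderiv F) x = ipoly g x * ipoly (pderiv h) x + ipoly h x * ipoly (pderiv g) x
      + of_int p * ipoly (pderiv r) x"
    unfolding hr by (simp add: pderiv_add pderiv_mult pderiv_smult)
  have H: "ipoly h x \<notin> P"
  proof
    assume "ipoly h x \<in> P"
    then have "ipoly (pderiv F) x \<in> P"
      unfolding der using g(1) p_mem by (intro P_add P_mult_right ipoly_mem_Zadj)
    then show False using assms by simp
  qed
  then have H0: "ipoly h x \<noteq> 0" using P_zero by auto
  have "ipoly g x * ipoly h x + of_int p * ipoly r x = 0"
    using F_root unfolding hr by simp
  then have G: "ipoly g x = of_int p * (- ipoly r x / ipoly h x)"
    using H0 by (simp add: field_simps)
  have l: "- ipoly r x / ipoly h x \<in> loc"
    using H by (intro locI uminus_mem ipoly_mem_Zadj)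
  show ?thesis
    by (rule DVR_if_generator[OF g p_mem _ l loc.one_mem G]) (use p_pos in simp_all)
qed

lemma xseq_mem: "j \<le> n \<Longrightarrow> xseq \<nu> j \<in> A"
  using ipoly_iterpoly_xseq[OF nu_nonneg, of "n - j" j] ipoly_mem_Zadj[of "iterpoly \<nu> (n - j)" x] by simp

text \<open>Since C_j is x_j^2 times an element of Z[x_n], it lies in P, hence \<open>p\<close>
  divides it, and exactly once. So C_j / p is a local unit and the ramified criterion applies with
  \<open>w\<close> = x_j.\<close>

lemma DVR_if_xseq_mem:
  assumes j: "1 \<le> j" "j \<le> n" "xseq \<nu> j \<in> P"
    and crit: "p dvd crit \<nu> j \<Longrightarrow> \<not> p\<^sup>2 dvd crit \<nu> j"
  shows "DVR (real_ring loc)"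
proof -
  obtain h where h: "iterpoly \<nu> j = [:crit \<nu> j:] + [:0, 0, 1:] * h" using iterpoly_even[OF j(1)] .
  let ?y = "xseq \<nu> j"
  have "ipoly h ?y \<in> A"
  proof -
    \<comment> \<open>As x_j is an iterate of t^2 - \<open>\<nu>\<close> evaluated at x_n, composing
      \<open>h\<close> with that iterate exhibits h(x_j) as an element of Z[x_n].\<close>
    have "ipoly (pcompose h (iterpoly \<nu> (n - j))) x = ipoly h ?y"
      using ipoly_iterpoly_xseq[OF nu_nonneg, of "n - j" j] j(2) by (simp add: ipoly_pcompose)
    then show ?thesis using ipoly_mem_Zadj by metis
  qed
  have "ipoly ([:crit \<nu> j:] + [:0, 0, 1:] * h) ?y = 0"
    using iterpoly_root[OF nu_nonneg, of j] unfolding h[symmetric] .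
  then have eq: "of_int (crit \<nu> j) = ?y\<^sup>2 * (- ipoly h ?y)"
    by (simp add: power2_eq_square algebra_simps)
  also have "\<dots> \<in> P"
    unfolding power2_eq_square using j xseq_mem \<open>ipoly h ?y \<in> A\<close>
    by (intro P_mult_right uminus_mem) auto
  finally have "p dvd crit \<nu> j" by (simp only: P_int)
  then obtain c where c: "crit \<nu> j = p * c" by blast
  have "\<not> p dvd c" using crit[OF \<open>p dvd _\<close>] c p_pos by (simp add: power2_eq_square)
  then have cP: "of_int c \<notin> P" by (simp only: P_int not_False_eq_True)
  have "real_of_int p * of_int c = ?y\<^sup>2 * (- ipoly h ?y)"
    using eq unfolding c by simp
  then show ?thesis
    using DVR_if_ramified[OF j(3) uminus_mem[OF \<open>ipoly h ?y \<in> A\<close>] of_int_mem cP] by blast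
qed

lemma DVR_loc_xseq:
  assumes n: "n \<ge> 1"
    and crit: "\<And>j. 1 \<le> j \<Longrightarrow> p dvd crit \<nu> j \<Longrightarrow> \<not> p\<^sup>2 dvd crit \<nu> j"
  shows "DVR (real_ring loc)"
proof (cases "\<exists>j. 1 \<le> j \<and> j \<le> n \<and> xseq \<nu> j \<in> P")
  case True
  then show ?thesis using DVR_if_xseq_mem crit by blast
next
  case False
  then have notin: "xseq \<nu> j \<notin> P" if "1 \<le> j" "j \<le> n" for j using that by blast
  show ?thesis
  proof (cases "p = 2")
    case False
    have two: "(2::real) \<notin> P"
      using P_int[of 2] False prime_p primes_dvd_imp_eq[of p 2] by auto
    \<comment> \<open>By the chain rule this value is the product of 2 x_i over n-k < i <= n, and
      none of its factors lies in the prime ideal P.\<close>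
    have "ipoly (pderiv (iterpoly \<nu> k)) x \<notin> P" if "k \<le> n" for k
      using that
    proof (induction k)
      case 0
      show ?case using one_notin_P by (simp add: pderiv_pCons)
    next
      case (Suc k)
      have "ipoly (iterpoly \<nu> k) x = xseq \<nu> (n - k)"
        using ipoly_iterpoly_xseq[OF nu_nonneg, of k "n - k"] Suc.prems by simp
      then have "ipoly (iterpoly \<nu> k) x \<notin> P" using notin[of "n - k"] Suc.prems by simp
      moreover have "ipoly (pderiv (iterpoly \<nu> (Suc k))) x
          = 2 * (ipoly (iterpoly \<nu> k) x * ipoly (pderiv (iterpoly \<nu> k)) x)"
        by (simp add: pderiv_diff pderiv_power pderiv_pCons)
      moreover have "(2::real) \<in> A" using of_int_mem[of 2] by simp
      ultimately show ?case
        using two Suc.IH Suc.prems P_primeD mult_mem ipoly_mem_Zadj by (metis Suc_leD)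
    qed
    then show ?thesis using DVR_if_unramified by blast
  next
    case True
    have "odd \<nu>"
    proof
      assume "even \<nu>"
      then have "of_int \<nu> \<in> P" using P_int True by simp
      moreover have "(xseq \<nu> 1)\<^sup>2 = of_int \<nu>" using xseq_square[OF nu_nonneg, of 0] by simp
      ultimately show False
        using P_power[OF xseq_mem[of 1], of 2] notin[of 1] n by simp
    qed
    \<comment> \<open>Here \<open>w\<^sup>2\<close> = 2(-\<open>w\<close> - \<open>c\<close>) with
      \<open>c\<close> = (1 - \<open>\<nu>\<close>)/2. As \<open>\<nu>\<close> is 3 modulo 4,
      \<open>c\<close> is odd; since \<open>w\<close> lies in P, the factor -\<open>w\<close> -
      \<open>c\<close> is a local unit and the ramified criterion applies.\<close>
    define w where "w = xseq \<nu> 1 - 1"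
    have sq: "(xseq \<nu> 1)\<^sup>2 = of_int \<nu>" using xseq_square[OF nu_nonneg, of 0] by simp
    have wA: "w \<in> A" using xseq_mem[OF n] one_mem by (simp add: w_def diff_mem)
    obtain c where c: "1 - \<nu> = 2 * c" using \<open>odd \<nu>\<close> by (metis dvd_def odd_one odd_even_add even_diff)
    have cr: "1 - of_int \<nu> = 2 * real_of_int c" using arg_cong[OF c, of real_of_int] by simp
    have w2: "w\<^sup>2 = 2 * (- w - of_int c)"
      using sq cr by (simp add: w_def power2_eq_square algebra_simps)
    have "(2::real) \<in> P" using p_mem True by simp
    then have "w\<^sup>2 \<in> P"
      unfolding w2 using wA by (intro P_mult_right diff_mem uminus_mem of_int_mem)
    then have wP: "w \<in> P" using P_power[OF wA] by blast
    have "odd c" using c nu_mod_4 \<open>odd \<nu>\<close> by presburger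
    have "- w - of_int c \<notin> P"
    proof
      assume "- w - of_int c \<in> P"
      then have "- (w + (- w - of_int c)) \<in> P" using wP by (intro P_uminus P_add)
      then have "of_int c \<in> P" by simp
      then show False using P_int True \<open>odd c\<close> by simp
    qed
    then show ?thesis
      using DVR_if_ramified[OF wP one_mem diff_mem[OF uminus_mem[OF wA] of_int_mem]] w2 True
      by simp
  qed
qed

end

section \<open>The converse: regularity at (p, x_n) excludes divisibility by p^2\<close>

context xseq_ring begin

text \<open>The hypothesis is applied to P = (p, x_n) only. In a local principal ideal domain one of
  two generators of an ideal divides the other; with \<open>p\<^sup>2\<close> dividing C_n, either
  divisibility contradicts a single coefficient of a multiple of \<open>F\<close>.\<close>

lemma DVR_imp_square_not_dvd:
  fixes p :: int
  assumes n: "n \<ge> 1" and p: "prime p" "p dvd crit \<nu> n"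
    and dvr: "\<And>P. maximalideal P (real_ring A) \<Longrightarrow> {k. of_int k \<in> P} = {k. p dvd k} \<Longrightarrow>
      DVR (real_ring (localization A P))"
  shows "\<not> p\<^sup>2 dvd crit \<nu> n"
proof
  assume p2: "p\<^sup>2 dvd crit \<nu> n"
  interpret A: real_subring A by (rule real_subring_Zadj)
  \<comment> \<open>This is the kernel of taking the constant term modulo \<open>p\<close>, well
    defined on Z[t]/(F) because \<open>p\<close> divides the constant term of
    \<open>F\<close>.\<close>
  define P where "P = {ipoly q x | q. p dvd coeff q 0}"
  have P_iff: "ipoly q x \<in> P \<longleftrightarrow> p dvd coeff q 0" for q
  proof
    assume "ipoly q x \<in> P"
    then obtain r where r: "ipoly q x = ipoly r x" "p dvd coeff r 0" by (auto simp: P_def)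
    then have "ipoly (q - r) x = 0" by simp
    then obtain s where s: "q - r = F * s" by (rule root_multiple)
    have "coeff q 0 = coeff r 0 + crit \<nu> n * coeff s 0"
      using arg_cong[OF s, of "\<lambda>t. coeff t 0"] by (simp add: coeff_mult_0 coeff_iterpoly_0)
    then show "p dvd coeff q 0" using r(2) p(2) by simp
  qed (auto simp: P_def)
  have P_ideal: "ideal P (real_ring A)"
  proof (rule A.ideal_real_ringI)
    show "P \<subseteq> A" using ipoly_mem_Zadj by (auto simp: P_def)
    show "0 \<in> P" using P_iff[of 0] by simp
    fix a b assume a: "a \<in> P"
    then obtain q where q: "a = ipoly q x" "p dvd coeff q 0" by (auto simp: P_def)
    show "a + b \<in> P" if b: "b \<in> P"
    proof -
      obtain r where "b = ipoly r x" "p dvd coeff r 0" using b by (auto simp: P_def)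
      then show ?thesis using P_iff[of "q + r"] q by simp
    qed
    show "b * a \<in> P" if b: "b \<in> A"
    proof -
      obtain r where "b = ipoly r x" using b by (rule ZadjE)
      then show ?thesis using P_iff[of "r * q"] q by (simp add: coeff_mult_0)
    qed
  qed
  have P_int: "of_int k \<in> P \<longleftrightarrow> p dvd k" for k
    using P_iff[of "[:k:]"] by simp
  have one: "1 \<notin> P" using P_int[of 1] p(1) not_prime_unit by auto
  have max: "maximalideal P (real_ring A)"
  proof (rule maximalidealI[OF P_ideal])
    show "carrier (real_ring A) \<noteq> P" using one A.one_mem by auto
    fix J assume J: "ideal J (real_ring A)" "P \<subseteq> J" "J \<subseteq> carrier (real_ring A)"
    show "J = P \<or> J = carrier (real_ring A)"
    proof (cases "J = P")
      case False
      then obtain a where a: "a \<in> J" "a \<notin> P" using J(2) by auto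
      then obtain q where q: "a = ipoly q x" using J(3) by (auto elim: ZadjE)
      then have "\<not> p dvd coeff q 0" using a P_iff by simp
      \<comment> \<open>The residue ring is Z/p: an inverse \<open>u\<close> of the constant term
        modulo \<open>p\<close> inverts \<open>a\<close> modulo P, so 1 lies in
        \<open>J\<close>.\<close>
      then have "coprime (coeff q 0) p" using p(1) by (metis coprime_commute prime_imp_coprime)
      then obtain u v where uv: "u * coeff q 0 + v * p = 1"
        using bezout_int[of "coeff q 0" p] by (auto simp: coprime_iff_gcd_eq_1)
      have "ipoly (1 - smult u q) x \<in> P"
        unfolding P_iff using uv by (simp add: algebra_simps flip: uv)
      then have "ipoly (1 - smult u q) x \<in> J" using J(2) by blast
      moreover have "of_int u * a \<in> J" using A.ideal_mult[OF J(1) a(1) A.of_int_mem] .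
      ultimately have "1 \<in> J" using A.ideal_add[OF J(1)] q by fastforce
      then have "A \<subseteq> J" using A.ideal_mult[OF J(1)] by fastforce
      then show ?thesis using J(3) by auto
    qed simp
  qed
  interpret real_prime_ideal A P
    by (intro real_prime_ideal.intro real_prime_ideal_axioms.intro A.real_subring_axioms
        cring.maximalideal_prime[OF A.cring_real_ring max])
  have "DVR (real_ring loc)" using dvr[OF max] P_int by simp
  then have pd: "principal_domain (real_ring loc)" by (simp add: DVR_def)
  have xA: "x \<in> A" using ipoly_mem_Zadj[of "[:0, 1:]" x] by simp
  have pA: "of_int p \<in> A" by (rule A.of_int_mem)
  define I where "I = {of_int p * a + x * b | a b. a \<in> loc \<and> b \<in> loc}"
  have "ideal I (real_ring loc)"
  proof (rule loc.ideal_real_ringI)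
    show "I \<subseteq> loc"
      using A_loc[OF xA] A_loc[OF pA] by (auto simp: I_def intro!: loc.add_mem loc.mult_mem)
    have "of_int p * 0 + x * 0 \<in> I" unfolding I_def using loc.zero_mem by blast
    then show "0 \<in> I" by simp
    fix a b assume "a \<in> I"
    then obtain c d where cd: "a = of_int p * c + x * d" "c \<in> loc" "d \<in> loc" by (auto simp: I_def)
    show "a + b \<in> I" if b: "b \<in> I"
    proof -
      obtain c' d' where cd': "b = of_int p * c' + x * d'" "c' \<in> loc" "d' \<in> loc"
        using b by (auto simp: I_def)
      have "a + b = of_int p * (c + c') + x * (d + d')" using cd cd' by (simp add: algebra_simps)
      then show ?thesis unfolding I_def using cd cd' loc.add_mem by blast
    qed
    show "b * a \<in> I" if "b \<in> loc"
    proof -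
      have "b * a = of_int p * (b * c) + x * (b * d)" using cd by (simp add: algebra_simps)
      then show ?thesis unfolding I_def using cd that loc.mult_mem by blast
    qed
  qed
  then obtain d where d: "d \<in> loc" "I = {b * d | b. b \<in> loc}"
    using principal_domain.exists_gen[OF pd]
    unfolding loc.cgenideal_real_ring real_ring_simps by blast
  have "of_int p * 1 + x * 0 \<in> I" "of_int p * 0 + x * 1 \<in> I"
    unfolding I_def using loc.zero_mem loc.one_mem by blast+
  then have "of_int p \<in> I" "x \<in> I" by simp_all
  then obtain a b where ab: "of_int p = a * d" "a \<in> loc" "x = b * d" "b \<in> loc"
    unfolding d(2) by blast
  have "1 * d \<in> I" unfolding d(2) using loc.one_mem by blast
  then have "d \<in> I" by simp
  then obtain \<alpha> \<beta> where \<alpha>\<beta>: "d = of_int p * \<alpha> + x * \<beta>" "\<alpha> \<in> loc" "\<beta> \<in> loc"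
    unfolding I_def by blast
  have d0: "d \<noteq> 0" using ab(1) p(1) by auto
  have "d * 1 = d * (a * \<alpha> + b * \<beta>)" using \<alpha>\<beta>(1) unfolding ab(1,3) by (simp add: algebra_simps)
  \<comment> \<open>As \<open>d\<close> generates (p, x_n), cancelling it leaves a relation showing
    that the cofactors \<open>a\<close> of \<open>p\<close> and \<open>b\<close> of x_n are not both
    in the maximal ideal.\<close>
  then have unit: "a * \<alpha> + b * \<beta> = 1" using d0 by (metis mult_left_cancel)
  obtain a1 a2 where a: "a = a1 / a2" "a1 \<in> A" "a2 \<in> A" "a2 \<notin> P" "a2 \<noteq> 0"
    using ab(2) by (rule locE)
  obtain b1 b2 where b: "b = b1 / b2" "b1 \<in> A" "b2 \<in> A" "b2 \<notin> P" "b2 \<noteq> 0"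
    using ab(4) by (rule locE)
  obtain e1 e2 where e: "\<alpha> = e1 / e2" "e1 \<in> A" "e2 \<in> A" "e2 \<notin> P" "e2 \<noteq> 0"
    using \<alpha>\<beta>(2) by (rule locE)
  obtain f1 f2 where f: "\<beta> = f1 / f2" "f1 \<in> A" "f2 \<in> A" "f2 \<notin> P" "f2 \<noteq> 0"
    using \<alpha>\<beta>(3) by (rule locE)
  have "a1 \<notin> P \<or> b1 \<notin> P"
  proof (rule ccontr)
    assume "\<not> ?thesis"
    then have "a1 * (e1 * (b2 * f2)) + b1 * (f1 * (a2 * e2)) \<in> P"
      using a b e f by (intro P_add P_mult_right A.mult_mem) auto
    moreover have "a1 * (e1 * (b2 * f2)) + b1 * (f1 * (a2 * e2)) = (a2 * e2) * (b2 * f2)"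
      using unit a b e f by (simp add: field_simps)
    moreover have "(a2 * e2) * (b2 * f2) \<notin> P"
      using a b e f P_primeD A.mult_mem by metis
    ultimately show False by simp
  qed
  then show False
  proof
    \<comment> \<open>Here \<open>a\<close> is a local unit, so \<open>p\<close> divides x_n
      locally: t s - p r is a multiple of \<open>F\<close> with s(x_n) outside P. As
      \<open>F\<close> has no linear term, comparing coefficients of t shows that \<open>p\<close>
      divides the constant term of \<open>s\<close>, a contradiction.\<close>
    assume a1: "a1 \<notin> P"
    then have "a1 \<noteq> 0" using P_zero by auto
    have "x * (a1 * b2) = of_int p * (b1 * a2)"
      using ab(1,3) a b \<open>a1 \<noteq> 0\<close> d0 by (simp add: field_simps)
    moreover have "a1 * b2 \<in> A" "a1 * b2 \<notin> P" "b1 * a2 \<in> A"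
      using a b a1 A.mult_mem P_primeD by blast+
    ultimately obtain s r where sr: "x * ipoly s x = of_int p * ipoly r x" "ipoly s x \<notin> P"
      by (metis ZadjE)
    then have "ipoly (pCons 0 s - smult p r) x = 0" by simp
    then obtain w where w: "pCons 0 s - smult p r = F * w" by (rule root_multiple)
    obtain h where h: "F = [:crit \<nu> n:] + [:0, 0, 1:] * h" using iterpoly_even[OF n] .
    have "coeff (F * w) 1 = crit \<nu> n * coeff w 1"
      by (subst h) (simp add: ring_distribs)
    then have "coeff s 0 = p * coeff r 1 + crit \<nu> n * coeff w 1"
      using arg_cong[OF w, of "\<lambda>t. coeff t 1"] by simp
    then have "p dvd coeff s 0" using p(2) by simp
    then show False using P_iff sr(2) by simp
  next
    \<comment> \<open>Now x_n divides \<open>p\<close> locally, and p s - t r is a multiple of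
      \<open>F\<close>. Comparing constant terms, \<open>p\<^sup>2\<close> divides \<open>p\<close>
      times the constant term of \<open>s\<close>, so s(x_n) would lie in P.\<close>
    assume b1: "b1 \<notin> P"
    then have "b1 \<noteq> 0" using P_zero by auto
    have "of_int p * (b1 * a2) = x * (a1 * b2)"
      using ab(1,3) a b \<open>b1 \<noteq> 0\<close> d0 by (simp add: field_simps)
    moreover have "b1 * a2 \<in> A" "b1 * a2 \<notin> P" "a1 * b2 \<in> A"
      using a b b1 A.mult_mem P_primeD by blast+
    ultimately obtain s r where sr: "of_int p * ipoly s x = x * ipoly r x" "ipoly s x \<notin> P"
      by (metis ZadjE)
    then have "ipoly (smult p s - pCons 0 r) x = 0" by simp
    then obtain w where w: "smult p s - pCons 0 r = F * w" by (rule root_multiple)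
    have "p * coeff s 0 = crit \<nu> n * coeff w 0"
      using arg_cong[OF w, of "\<lambda>t. coeff t 0"] by (simp add: coeff_mult_0 coeff_iterpoly_0)
    then have "p * p dvd p * coeff s 0" using p2 by (simp add: power2_eq_square)
    then have "p dvd coeff s 0" using p(1) by auto
    then show False using P_iff sr(2) by simp
  qed
qed

end

section \<open>The two implications\<close>

theorem theorem1p6:
  fixes \<nu> :: int and p :: nat
  assumes "\<nu> \<ge> 3" and "squarefree \<nu>" and "\<nu> mod 4 = 2 \<or> \<nu> mod 4 = 3"
    and "Factorial_Ring.prime p" and "\<exists>n\<ge>1. int p dvd Cn \<nu> n"
  shows "(\<not> (int p)^2 dvd Cn \<nu> (np \<nu> p) \<longrightarrow>
           (\<forall>n\<ge>1. \<forall>P. maximalideal P (real_ring (Zadj (xseq \<nu> n))) \<and>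
                 {k::int. of_int k \<in> P} = {k. int p dvd k} \<longrightarrow>
               DVR (real_ring (localization (Zadj (xseq \<nu> n)) P))))
       \<and> ((\<forall>P. maximalideal P (real_ring (Zadj (xseq \<nu> (np \<nu> p)))) \<and>
                 {k::int. of_int k \<in> P} = {k. int p dvd k} \<longrightarrow>
               DVR (real_ring (localization (Zadj (xseq \<nu> (np \<nu> p))) P)))
           \<longrightarrow> \<not> (int p)^2 dvd Cn \<nu> (np \<nu> p))"
proof -
  have \<nu>: "\<nu> \<ge> 0" using assms(1) by simp
  have Cn: "Cn \<nu> n = crit \<nu> n" for n by (rule Cn_eq_crit[OF \<nu> assms(3)])
  have p: "prime (int p)" using assms(4) by simp
  let ?m = "np \<nu> p"
  have m: "?m \<ge> 1 \<and> int p dvd Cn \<nu> ?m"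
    unfolding np_def by (rule LeastI_ex) (use assms(5) in blast)
  have least: "?m \<le> j" if "1 \<le> j" "int p dvd crit \<nu> j" for j
    unfolding np_def by (rule Least_le) (use that Cn in simp)
  show ?thesis
  proof (intro conjI impI allI)
    fix n P
    assume p2: "\<not> (int p)\<^sup>2 dvd Cn \<nu> ?m" and n: "1 \<le> n"
      and P: "maximalideal P (real_ring (Zadj (xseq \<nu> n))) \<and> {k. of_int k \<in> P} = {k. int p dvd k}"
    interpret A: real_subring "Zadj (xseq \<nu> n)" by (rule real_subring_Zadj)
    have pr: "primeideal P (real_ring (Zadj (xseq \<nu> n)))"
      using cring.maximalideal_prime[OF A.cring_real_ring] P by blast
    interpret xseq_prime \<nu> n P "int p"
      by (intro xseq_prime.intro xseq_ring.intro real_prime_ideal.intro xseq_prime_axioms.intro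
          real_prime_ideal_axioms.intro A.real_subring_axioms \<nu> assms(3) pr p) (use P in blast)
    show "DVR (real_ring (localization (Zadj (xseq \<nu> n)) P))"
      \<comment> \<open>Periodicity modulo p^2 spreads the hypothesis on C_n(p) to every C_j that p
        divides, whatever the index \<open>n\<close> of the ring.\<close>
      by (rule DVR_loc_xseq[OF n], rule square_not_dvd_crit[of ?m])
        (use m p2 least Cn in auto)
  next
    assume dvr: "\<forall>P. maximalideal P (real_ring (Zadj (xseq \<nu> ?m))) \<and>
        {k. of_int k \<in> P} = {k. int p dvd k} \<longrightarrow>
        DVR (real_ring (localization (Zadj (xseq \<nu> ?m)) P))"
    interpret xseq_ring \<nu> ?m by standard (use \<nu> assms(3) in auto)
    show "\<not> (int p)\<^sup>2 dvd Cn \<nu> ?m"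
      unfolding Cn by (rule DVR_imp_square_not_dvd) (use m p dvr Cn in auto)
  qed
qed

end
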